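(* In (classical) continuous Tarski geometry with Skolem functions, the terms $ilc_1(a,b,c,d)$ and $ilc_2(a,b,c,d)$ (the two intersection points of $\mathrm{Line}(a,b)$ with the circle with center $c$ through $d$) are provably continuous in $a$, $b$, $c$, and $d$ (when their definedness conditions hold).
   Context: Language: one sort (points), equality, strict betweenness $B(a,b,c)$, congruence $E(a,b,c,d)$ written $ab=cd$, constants $\alpha,\beta,\gamma$, and (total) function symbols $ext$ (4-ary), $ip$ (5-ary), $center$ (3-ary), $ilc_1,ilc_2$ (4-ary). Abbreviations: $T(a,b,c):=\neg(a\neq b\land b\neq c\land\neg B(a,b,c))$; $Col(a,b,c):=\neg(\neg T(c,a,b)\land\neg T(a,c,b)\land\neg T(a,b,c))$; $SameOrder(a,b,c,d):=(T(c,a,b)\to\neg B(d,c,a))\land(T(a,c,b)\to\neg B(d,c,b))\land(T(a,b,c)\to T(a,c,d))$. A point $e$ is (non-strictly) inside the circle with center $m$ through $n$ if $me\le mn$, i.e. there is $x$ with $T(m,x,n)$ and $mx=me$. Definedness condition for $ilc_i(a,b,c,d)$: $a\neq b$ and the line meets the circle, i.e. there is a point on $\mathrm{Line}(a,b)$ that is (non-strictly) inside the circle with center $c$ through $d$. When it holds, $ilc_1(a,b,c,d)$ and $ilc_2(a,b,c,d)$ are the two intersection points of the line and the circle (equal when the line is tangent), occurring on the line in the same order as $a$ and $b$. Continuity of a term $t(x_1,\dots,x_n)$ (at arguments satisfying its definedness condition): for every (non-degenerate) circle $C$ with center $t(x)$, given by $t(x)$ and a point of $C$, there exist (non-degenerate)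 circles $K_i$ about $x_i$ such that if $z_i$ is inside $K_i$ for $i=1,\dots,n$ (and $z$ satisfies the definedness condition), then $t(z)$ is inside $C$. Axioms (classical predicate logic with equality): (A1) $ab=ba$; (A2) $ab=pq\land ab=rs\to pq=rs$; (A3) $ab=cc\to a=b$; (A4-i) $q\neq a\to T(q,a,x)\land ax=bc$ with $x=ext(q,a,b,c)$; (A5) $a\neq b\land T(a,b,c)\land T(A,B,C)\land ab=AB\land bc=BC\land ad=AD\land bd=BD\to cd=CD$; (A6-i) $\neg B(a,b,a)$; (A7-i) $B(a,p,c)\land T(b,q,c)\land\neg Col(a,b,c)\to B(p,x,b)\land B(q,x,a)$ with $x=ip(a,p,c,b,q)$; (A8) $\neg Col(\alpha,\beta,\gamma)$; (A9) $a\neq b\land pa=pb\land qa=qb\land ra=rb\to Col(p,q,r)$; (A10$_3$) $\neg Col(a,b,c)\to ax=bx\land ax=cx$ with $x=center(a,b,c)$; (A14-i) $B(a,b,c)\to B(c,b,a)$; (A15-i) $B(a,b,d)\land B(b,c,d)\to B(a,b,c)$; two-point line-circle: $Col(u,v,p)\land u\neq v\land T(a,p,b)\to Col(u,v,y)\land Col(u,v,z)\land ay=ab\land az=ab\land T(y,p,z)\land(p\neq a\to y\neq z)$, with $y=ilc_1(u,v,a,b)$, $z=ilc_2(u,v,a,b)$; more generally, whenever the definedness condition holds for $u,v,a,b$, the points $y$ and $z$ lie on $\mathrm{Line}(u,v)$ and $ay=az=ab$; and $u\neq v\to SameOrder(u,v,y,z)$.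
   Formalization: Two axioms contradictory as printed are corrected: A7-i assumes strict B(b,q,c) for T(b,q,c), and the two-point axiom gives y≠z only if also p≠b (tangent at b forces y=z); that ilc_1, ilc_2 are all the intersection points is stated as an axiom. *)

theory Defs
  imports Main
begin

locale tarski_language =
  fixes B :: "'p \<Rightarrow> 'p \<Rightarrow> 'p \<Rightarrow> bool"
    and E :: "'p \<Rightarrow> 'p \<Rightarrow> 'p \<Rightarrow> 'p \<Rightarrow> bool"
begin

text \<open>\<open>B\<close> is strict betweenness and \<open>E a b c d\<close> is the congruence \<open>ab = cd\<close>.\<close>

definition T :: "'p \<Rightarrow> 'p \<Rightarrow> 'p \<Rightarrow> bool" where
  "T a b c \<longleftrightarrow> \<not> (a \<noteq> b \<and> b \<noteq> c \<and> \<not> B a b c)"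

definition Col :: "'p \<Rightarrow> 'p \<Rightarrow> 'p \<Rightarrow> bool" where
  "Col a b c \<longleftrightarrow> \<not> (\<not> T c a b \<and> \<not> T a c b \<and> \<not> T a b c)"

definition SameOrder :: "'p \<Rightarrow> 'p \<Rightarrow> 'p \<Rightarrow> 'p \<Rightarrow> bool" where
  "SameOrder a b c d \<longleftrightarrow>
     (T c a b \<longrightarrow> \<not> B d c a) \<and> (T a c b \<longrightarrow> \<not> B d c b) \<and> (T a b c \<longrightarrow> T a c d)"

text \<open>\<open>inside m n e\<close>: the point \<open>e\<close> is non-strictly inside the circle with center \<open>m\<close> through
  \<open>n\<close>. The circle is degenerate if \<open>m = n\<close>.\<close>

definition inside :: "'p \<Rightarrow> 'p \<Rightarrow> 'p \<Rightarrow> bool" where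
  "inside m n e \<longleftrightarrow> (\<exists>x. T m x n \<and> E m x m e)"

definition ilc_defined :: "'p \<Rightarrow> 'p \<Rightarrow> 'p \<Rightarrow> 'p \<Rightarrow> bool" where
  "ilc_defined a b c d \<longleftrightarrow> a \<noteq> b \<and> (\<exists>e. Col a b e \<and> inside c d e)"

text \<open>Joint continuity of a 4-ary term \<open>t\<close> at all arguments satisfying its definedness condition
  \<open>D\<close>. The quantified \<open>r\<close> and \<open>k\<^sub>i\<close> are points on the circles, whose centers are
  \<open>t x\<^sub>1 x\<^sub>2 x\<^sub>3 x\<^sub>4\<close> and \<open>x\<^sub>i\<close>.\<close>

definition continuous_term4 ::
  "('p \<Rightarrow> 'p \<Rightarrow> 'p \<Rightarrow> 'p \<Rightarrow> bool) \<Rightarrow> ('p \<Rightarrow> 'p \<Rightarrow> 'p \<Rightarrow> 'p \<Rightarrow> 'p) \<Rightarrow> bool" where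
  "continuous_term4 D t \<longleftrightarrow>
     (\<forall>x\<^sub>1 x\<^sub>2 x\<^sub>3 x\<^sub>4. D x\<^sub>1 x\<^sub>2 x\<^sub>3 x\<^sub>4 \<longrightarrow>
       (\<forall>r. r \<noteq> t x\<^sub>1 x\<^sub>2 x\<^sub>3 x\<^sub>4 \<longrightarrow>
         (\<exists>k\<^sub>1 k\<^sub>2 k\<^sub>3 k\<^sub>4. k\<^sub>1 \<noteq> x\<^sub>1 \<and> k\<^sub>2 \<noteq> x\<^sub>2 \<and> k\<^sub>3 \<noteq> x\<^sub>3 \<and> k\<^sub>4 \<noteq> x\<^sub>4 \<and>
           (\<forall>z\<^sub>1 z\<^sub>2 z\<^sub>3 z\<^sub>4.
              inside x\<^sub>1 k\<^sub>1 z\<^sub>1 \<and> inside x\<^sub>2 k\<^sub>2 z\<^sub>2 \<and> inside x\<^sub>3 k\<^sub>3 z\<^sub>3 \<and> inside x\<^sub>4 k\<^sub>4 z\<^sub>4 \<and>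
              D z\<^sub>1 z\<^sub>2 z\<^sub>3 z\<^sub>4 \<longrightarrow>
              inside (t x\<^sub>1 x\<^sub>2 x\<^sub>3 x\<^sub>4) r (t z\<^sub>1 z\<^sub>2 z\<^sub>3 z\<^sub>4)))))"

end

text \<open>The models, with universe \<open>'p\<close>, of continuous Tarski geometry with Skolem functions.

  In \<open>A7\<close> both betweenness hypotheses are strict: with only \<open>T b q c\<close> the strict conclusion
  would fail for \<open>q = b\<close> and \<open>q = c\<close>.

  In \<open>line_circle_two_points\<close> the guard \<open>p \<noteq> b\<close> excludes a line tangent at \<open>b\<close>, for which
  \<open>y = z\<close>.

  The last clause of \<open>line_circle\<close> says that \<open>y\<close> and \<open>z\<close> are all the intersection points
  (so \<open>y = z\<close> only in case of tangency or a degenerate circle). It is not implied by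
  \<open>line_circle_two_points\<close>, which only concerns lines that meet the segment \<open>ab\<close>.\<close>

locale continuous_tarski = tarski_language B E
  for B :: "'p \<Rightarrow> 'p \<Rightarrow> 'p \<Rightarrow> bool"
    and E :: "'p \<Rightarrow> 'p \<Rightarrow> 'p \<Rightarrow> 'p \<Rightarrow> bool" +
  fixes \<alpha> \<beta> \<gamma> :: 'p
    and ext :: "'p \<Rightarrow> 'p \<Rightarrow> 'p \<Rightarrow> 'p \<Rightarrow> 'p"
    and ip :: "'p \<Rightarrow> 'p \<Rightarrow> 'p \<Rightarrow> 'p \<Rightarrow> 'p \<Rightarrow> 'p"
    and center :: "'p \<Rightarrow> 'p \<Rightarrow> 'p \<Rightarrow> 'p"
    and ilc\<^sub>1 ilc\<^sub>2 :: "'p \<Rightarrow> 'p \<Rightarrow> 'p \<Rightarrow> 'p \<Rightarrow> 'p"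
  assumes A1: "E a b b a"
    and A2: "E a b p q \<and> E a b r s \<longrightarrow> E p q r s"
    and A3: "E a b c c \<longrightarrow> a = b"
    and A4: "x = ext q a b c \<Longrightarrow> q \<noteq> a \<longrightarrow> T q a x \<and> E a x b c"
    and A5: "a \<noteq> b \<and> T a b c \<and> T a' b' c' \<and> E a b a' b' \<and> E b c b' c' \<and> E a d a' d' \<and> E b d b' d'
             \<longrightarrow> E c d c' d'"
    and A6: "\<not> B a b a"
    and A7: "x = ip a p c b q \<Longrightarrow>
             B a p c \<and> B b q c \<and> \<not> Col a b c \<longrightarrow> B p x b \<and> B q x a"
    and A8: "\<not> Col \<alpha> \<beta> \<gamma>"
    and A9: "a \<noteq> b \<and> E p a p b \<and> E q a q b \<and> E r a r b \<longrightarrow> Col p q r"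
    and A10: "x = center a b c \<Longrightarrow> \<not> Col a b c \<longrightarrow> E a x b x \<and> E a x c x"
    and A14: "B a b c \<longrightarrow> B c b a"
    and A15: "B a b d \<and> B b c d \<longrightarrow> B a b c"
    and line_circle_two_points:
      "y = ilc\<^sub>1 u v a b \<Longrightarrow> z = ilc\<^sub>2 u v a b \<Longrightarrow>
       Col u v p \<and> u \<noteq> v \<and> T a p b \<longrightarrow>
         Col u v y \<and> Col u v z \<and> E a y a b \<and> E a z a b \<and> T y p z \<and>
         (p \<noteq> a \<and> p \<noteq> b \<longrightarrow> y \<noteq> z)"
    and line_circle:
      "y = ilc\<^sub>1 u v a b \<Longrightarrow> z = ilc\<^sub>2 u v a b \<Longrightarrow>
       ilc_defined u v a b \<longrightarrow>
         Col u v y \<and> Col u v z \<and> E a y a b \<and> E a z a b \<and>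
         (\<forall>w. Col u v w \<and> E a w a b \<longrightarrow> w = y \<or> w = z)"
    and line_circle_order:
      "y = ilc\<^sub>1 u v a b \<Longrightarrow> z = ilc\<^sub>2 u v a b \<Longrightarrow> u \<noteq> v \<longrightarrow> SameOrder u v y z"

end

theory Submission
  imports Defs
begin

text \<open>If the line is a secant, enclose the intersection point \<open>y\<close> between two points of the line close
  to it, one outside and one inside the circle. A slightly perturbed line passes close to both of
  them, the first stays outside the perturbed circle and the second inside, so one intersection
  point is caught between them; the order prescribed by \<open>SameOrder\<close> decides which one. If the line is
  tangent, both enclosing points are outside, while the perturbed line still has a point between them
  that is closer to the center; by convexity of discs it does not meet the perturbed circle beyond
  the enclosing points. Distances are controlled by the triangle inequality, which follows from the
  fact that a line meets a circle in at most two points. That a perturbed line passes close to a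
  given point of the line is a consequence of plane separation.\<close>

text \<open>At most two intersections force strict convexity of discs; so the foot of a
  perpendicular is the nearest point of its line, a leg is no longer than the hypotenuse, and
  projecting a corner of a triangle to the opposite side reduces the triangle inequality to
  collinear points. For separation, only the inner form of Pasch is an axiom; half-turns, which are
  isometries, turn outer positions into inner ones. \<open>SameOrder\<close> is awkward because its
  clauses depend on where the points lie relative to \<open>a\<close> and \<open>b\<close>; measured
  from an origin on the line behind all of the points it becomes the comparison of two distances,
  and such an origin survives a perturbation. Lengths are only compared: a sum is a segment divided
  by a point, a margin is the rest of a segment. The estimates have two stages: a tolerance
  \<epsilon> within which all strict relations between the chosen points persist, and then a
  \<delta> for which the perturbed line has points within \<epsilon> of them.\<close>

text \<open>A length is represented by the set of all shorter segments, ordered by inclusion; the copy of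
  the type of sets keeps the automation from reasoning about elements.\<close>

typedef 'p length = "UNIV :: ('p \<times> 'p) set set" by simp

setup_lifting type_definition_length

instantiation length :: (type) order
begin

lift_definition less_eq_length :: "'a length \<Rightarrow> 'a length \<Rightarrow> bool" is "(\<subseteq>)" .
lift_definition less_length :: "'a length \<Rightarrow> 'a length \<Rightarrow> bool" is "(\<subset>)" .

instance by standard (transfer; blast)+

end

context continuous_tarski
begin

subsection \<open>Betweenness and congruence\<close>

lemma E_refl: "E a b a b" using A1 A2 by blast
lemma E_sym: "E a b c d \<Longrightarrow> E c d a b" using A2 E_refl by blast
lemma E_trans: "E a b c d \<Longrightarrow> E c d e f \<Longrightarrow> E a b e f" using A2 E_sym by blast
lemma E_swap1: "E a b c d \<longleftrightarrow> E b a c d" using A1 E_trans by blast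
lemma E_swap2: "E a b c d \<longleftrightarrow> E a b d c" using A1 E_trans by blast

lemma B_distinct: assumes "B a b c" shows "a \<noteq> b" "b \<noteq> c" "a \<noteq> c"
proof -
  \<comment> \<open>A15 with coinciding points turns \<open>B a a b\<close> into
    \<open>B a a a\<close>, which A6 forbids.\<close>
  have *: "\<not> B a a b" for a b using A15[of a a b a] A6 by blast
  then have "\<not> B b a a" for a b using A14 by blast
  then show "a \<noteq> b" "b \<noteq> c" "a \<noteq> c" using * A6 assms by blast+
qed

lemma T_iff: "T a b c \<longleftrightarrow> a = b \<or> b = c \<or> B a b c"
  unfolding T_def by blast
lemma T_triv [simp]: "T a a b" "T a b b" by (auto simp: T_iff)
lemma T_sym: "T a b c \<longleftrightarrow> T c b a" using A14 by (auto simp: T_iff)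
lemma T_iden [simp]: "T a b a \<longleftrightarrow> a = b" using A6 by (auto simp: T_iff)
lemma B_iff: "B a b c \<longleftrightarrow> T a b c \<and> a \<noteq> b \<and> b \<noteq> c"
  using B_distinct T_iff by blast

lemma exists_other: "\<exists>q::'p. q \<noteq> a"
proof (rule ccontr)
  assume "\<not> ?thesis"
  then have "\<alpha> = a" "\<beta> = a" by blast+
  then show False using A8 by (simp add: Col_def)
qed

lemma E_null: "E a a b b"
proof -
  obtain q where "q \<noteq> a" using exists_other by blast
  then obtain x where "E a x b b" using A4[OF refl, of q a b b] by blast
  then show ?thesis using A3 by metis
qed
lemma E_null_iff: "E a b c c \<longleftrightarrow> a = b" using A3 E_null by blast

text \<open>The congruence class of a pair: congruences become equations, so that chains of them can
  be left to the simplifier.\<close>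

definition seg :: "'p \<Rightarrow> 'p \<Rightarrow> ('p \<times> 'p) set" where
  "seg a b = {(x, y). E a b x y}"

lemma E_seg: "E a b c d \<longleftrightarrow> seg a b = seg c d"
  unfolding seg_def using E_trans E_sym E_refl by blast

lemma seg_commute: "seg a b = seg b a"
  using A1 E_seg by blast

lemma segment_ext: assumes "q \<noteq> a" shows "\<exists>x. T q a x \<and> E a x b c"
  using A4[OF refl] assms by blast

lemma five_segment:
  assumes "a \<noteq> b" "T a b c" "T a' b' c'" "E a b a' b'" "E b c b' c'" "E a d a' d'" "E b d b' d'"
  shows "E c d c' d'"
  using A5 assms by blast

text \<open>The five-segment axiom with the fourth point equal to the first.\<close>

lemma E_add: assumes "T a b c" "T a' b' c'" "E a b a' b'" "E b c b' c'" shows "E a c a' c'"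
proof (cases "a = b")
  case True then show ?thesis using assms A3 E_sym by blast
next
  case False
  then have "E c a c' a'"
    using five_segment[OF False assms, of a a'] E_null E_swap1 E_swap2 assms by blast
  then show ?thesis using E_swap1 E_swap2 by blast
qed

text \<open>The five-segment axiom compares \<open>x\<close> with \<open>y\<close>, taking
  \<open>x\<close> as the fourth point in both configurations: \<open>xx = yx\<close>.\<close>

lemma ext_unique: assumes "q \<noteq> a" "T q a x" "T q a y" "E a x a y" shows "x = y"
proof -
  have "E x x y x" using five_segment[OF assms(1-3) E_refl assms(4) E_refl E_refl] .
  then show ?thesis using A3 E_sym by blast
qed

lemma T_inner: assumes "T a b d" "T b c d" shows "T a b c"
  using assms A15[of a b d c] A6 by (auto simp: T_iff)

text \<open>Extending \<open>ac\<close> by \<open>cd\<close> gives a point \<open>x\<close> that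
  also extends \<open>bc\<close> by \<open>cd\<close>; uniqueness of extensions makes it
  \<open>d\<close>.\<close>

lemma T_outer: assumes "T a b c" "T b c d" "b \<noteq> c" shows "T a c d" "T a b d"
proof -
  have *: "T a c d" if "T a b c" "T b c d" "b \<noteq> c" for a b c d
  proof -
    have "a \<noteq> c" using that by auto
    then obtain x where x: "T a c x" "E c x c d" using segment_ext by blast
    have "T b c x" using T_inner[of x c a b] T_sym x that by blast
    then show ?thesis using ext_unique x that by blast
  qed
  show "T a c d" using * assms by blast
  show "T a b d" using *[of d c b a] assms T_sym by blast
qed

lemma T_inner2: assumes "T a b d" "T b c d" shows "T a c d"
proof (cases "b = c")
  case False then show ?thesis using T_outer T_inner assms by blast
qed (use assms in auto)

lemma T_exchange: assumes "T a b c" "T a c d" shows "T b c d" "T a b d"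
proof -
  have "T d c a" "T c b a" using assms T_sym by blast+
  then have "T d c b" "T d b a" using T_inner T_inner2 by blast+
  then show "T b c d" "T a b d" using T_sym by blast+
qed

text \<open>The center lies on the line, so it can serve as the inner point \<open>p\<close> of the
  two-point axiom and lies between the two intersections; by the last clause of
  \<open>line_circle\<close> these are \<open>c\<close> and \<open>c'\<close>.\<close>

lemma line_circle_center:
  assumes "a \<noteq> b" "Col a b c" "Col a b c'" "Col a b d" "E d c d c'" "c \<noteq> c'"
  shows "T c d c'"
proof -
  let ?y = "ilc\<^sub>1 a b d c" and ?z = "ilc\<^sub>2 a b d c"
  have i: "ilc_defined a b d c"
    unfolding ilc_defined_def inside_def using assms E_refl T_triv by blast
  have "T ?y d ?z" using line_circle_two_points[OF refl refl, of a b d d c] assms by simp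
  moreover have "c = ?y \<or> c = ?z" "c' = ?y \<or> c' = ?z"
    using line_circle[OF refl refl, of a b d c] i assms E_refl E_sym by blast+
  ultimately show ?thesis using assms(6) T_sym by auto
qed

text \<open>Extending \<open>ad\<close> by \<open>cd\<close> gives a point \<open>c'\<close> on the circle about \<open>d\<close> through \<open>c\<close>. A line has at most
  two points on this circle, and they lie on different sides of \<open>d\<close>; so \<open>c' = c\<close>, or \<open>d\<close> is
  between \<open>c\<close> and \<open>c'\<close>. In the second case \<open>b\<^sub>1 = b\<^sub>2\<close> is a common point beyond \<open>c\<close> and \<open>d\<close>.\<close>

lemma T_connect: assumes "a \<noteq> b" "T a b c" "T a b d" shows "T a c d \<or> T a d c"
proof (cases "b = c \<or> b = d")
  case True then show ?thesis using assms by auto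
next
  case False
  have ac: "a \<noteq> c" "a \<noteq> d" using assms by auto
  obtain c' where c': "T a d c'" "E d c' c d" using segment_ext ac by blast
  obtain d' where d': "T a c d'" "E c d' c d" using segment_ext ac by blast
  have ac': "a \<noteq> c'" "a \<noteq> d'" using ac c' d' by auto
  obtain b1 where b1: "T a c' b1" "E c' b1 c b" using segment_ext ac' by blast
  obtain b2 where b2: "T a d' b2" "E d' b2 d b" using segment_ext ac' by blast
  have t: "T b d c'" "T b c d'" "T d c' b1" "T c d' b2"
    using T_exchange assms c' d' b1 b2 by blast+
  have tt: "T a b c'" "T a b d'" "T a d b1" "T a c b2" "T a b b1" "T a b b2"
    using T_exchange(2) assms c' d' b1 b2 by meson+
  have "T b c' b1" "T b c b2"
    using T_exchange(1)[of a b] tt b1(1) assms(2) by auto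
  \<comment> \<open>From \<open>b\<close> to \<open>b1\<close> the pieces are \<open>bd\<close>,
    \<open>dc'\<close>, \<open>c'b1\<close>; from \<open>b2\<close> to \<open>b\<close> they are
    \<open>b2d'\<close>, \<open>d'c\<close>, \<open>cb\<close>, congruent one by one. So
    \<open>b1\<close> and \<open>b2\<close> are equally far from \<open>b\<close>.\<close>
  have "T b2 d' c" using t(4) T_sym by blast
  moreover have "E b d b2 d'" "E d c' d' c"
    using b2(2) c'(2) d'(2) E_seg seg_commute by auto
  ultimately have "E b c' b2 c" using E_add[OF t(1)] by blast
  moreover have "T b2 c b" using T_sym \<open>T b c b2\<close> by blast
  ultimately have "E b b1 b2 b"
    using E_add[OF \<open>T b c' b1\<close>, of b2 c b] b1 by blast
  then have "b1 = b2" using ext_unique[OF assms(1)] tt E_swap2 by blast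
  show ?thesis
  proof (cases "c = c'")
    case True then show ?thesis using c' by auto
  next
    case False
    have "T c d c'"
    proof (rule line_circle_center[OF assms(1) _ _ _ _ False])
      show "E d c d c'" using c'(2) E_sym E_swap1 by blast
    qed (use assms tt in \<open>auto simp: Col_def\<close>)
    show ?thesis
    proof (cases "d = c'")
      case True then have "c = d" using c'(2) A3[of c d d] E_sym by blast
      then show ?thesis by simp
    next
      case False
      then have "T c d b1" using T_outer \<open>T c d c'\<close> t by blast
      then show ?thesis using T_inner[of a c b1 d] tt \<open>b1 = b2\<close> by blast
    qed
  qed
qed

lemma T_antisym: "T a b c \<Longrightarrow> T a c b \<Longrightarrow> b = c"
  using T_exchange(1)[of a b c b] by simp

lemma T_antisym2: "T a b c \<Longrightarrow> T b a c \<Longrightarrow> a = b"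
  using T_antisym[of c b a] T_sym by blast

lemma T_connect2: assumes "a \<noteq> b" "T a b c" "T a b d" shows "T b c d \<or> T b d c"
  using T_connect[OF assms] T_exchange(1) assms by meson

lemma exists_beyond: "\<exists>p. p \<noteq> a \<and> T q a p"
proof (cases "q = a")
  case True then show ?thesis using exists_other by auto
next
  case False
  then obtain p where "T q a p" "E a p q a" using segment_ext by blast
  moreover from this have "p \<noteq> a" using False A3[of q a a] E_sym[of a p q a] by metis
  ultimately show ?thesis by blast
qed

text \<open>With \<open>p\<close> beyond \<open>a\<close> on the extension of \<open>da\<close>,
  both \<open>b\<close> and \<open>c\<close> extend \<open>pa\<close>, so connectivity
  applies.\<close>

lemma T_connect3: assumes "T a b d" "T a c d" shows "T a b c \<or> T a c b"
proof -
  obtain p where p: "p \<noteq> a" "T d a p" using exists_beyond by blast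
  have "T d b a" "T d c a" using assms T_sym by blast+
  then have "T b a p" "T c a p" using T_exchange p by blast+
  then have "T p a b" "T p a c" using T_sym by blast+
  then show ?thesis using T_connect2 p(1) by blast
qed

text \<open>Lay off \<open>ab\<close> and then \<open>bc\<close> from \<open>a'\<close> in the
  direction of \<open>c'\<close>, which is fixed by a point \<open>p\<close> behind
  \<open>a'\<close>; by uniqueness of extensions the end is \<open>c'\<close>.\<close>

lemma E_transport:
  assumes "T a b c" "E a c a' c'" shows "\<exists>b'. T a' b' c' \<and> E a b a' b' \<and> E b c b' c'"
proof -
  obtain p where p: "p \<noteq> a'" "T c' a' p" using exists_beyond by blast
  obtain b' where b: "T p a' b'" "E a' b' a b" using segment_ext p(1) by blast
  have "p \<noteq> b'" using p b by auto
  then obtain d where d: "T p b' d" "E b' d b c" using segment_ext by blast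
  have t: "T a' b' d" "T p a' d" "T p a' c'" using T_exchange b d p T_sym by blast+
  have "E a' d a c" using E_add t assms(1) b d by blast
  then have "d = c'" using ext_unique p t assms E_trans by blast
  then show ?thesis using t b d E_sym by blast
qed

subsection \<open>Comparison of lengths\<close>

definition shorter :: "'p \<Rightarrow> 'p \<Rightarrow> ('p \<times> 'p) set" where
  "shorter a b = {(x, y). \<exists>z. T a z b \<and> E x y a z}"

definition len :: "'p \<Rightarrow> 'p \<Rightarrow> 'p length" where
  "len a b = Abs_length (shorter a b)"

lemma len_le_shorter: "len a b \<le> len c d \<longleftrightarrow> shorter a b \<subseteq> shorter c d"
  by (simp add: len_def less_eq_length.abs_eq)

lemma len_le_iff: "len a b \<le> len c d \<longleftrightarrow> (\<exists>z. T c z d \<and> E a b c z)"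
proof
  assume "len a b \<le> len c d"
  then have "shorter a b \<subseteq> shorter c d" using len_le_shorter by blast
  moreover have "(a, b) \<in> shorter a b" unfolding shorter_def using E_refl T_triv by blast
  ultimately show "\<exists>z. T c z d \<and> E a b c z" unfolding shorter_def by blast
next
  assume "\<exists>z. T c z d \<and> E a b c z"
  then obtain z where z: "T c z d" "E a b c z" by blast
  show "len a b \<le> len c d" unfolding len_le_shorter
  proof
    fix s assume "s \<in> shorter a b"
    then obtain x y w where s: "s = (x, y)" "T a w b" "E x y a w" unfolding shorter_def by blast
    obtain w' where "T c w' z" "E a w c w'" using E_transport s z by blast
    then have "T c w' d" "E x y c w'" using T_exchange z s E_trans by blast+
    then show "s \<in> shorter c d" using s unfolding shorter_def by blast
  qed
qed

text \<open>Equality of the sets only says that each segment fits into the other. Composing the two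
  embeddings puts a copy of \<open>cd\<close> starting at \<open>c\<close> into \<open>cx\<close>, a
  part of \<open>cd\<close>; uniqueness of extensions forces \<open>x = d\<close>.\<close>

lemma E_len: "E a b c d \<longleftrightarrow> len a b = len c d"
proof
  assume "E a b c d"
  then show "len a b = len c d"
    using E_sym len_le_iff[of a b c d] len_le_iff[of c d a b] T_triv by (meson order.antisym)
next
  assume "len a b = len c d"
  then have "len a b \<le> len c d" "len c d \<le> len a b" by auto
  then obtain x y where x: "T c x d" "E a b c x" and y: "T a y b" "E c d a y"
    using len_le_iff by blast
  obtain y' where y': "T c y' x" "E a y c y'" using E_transport y x by blast
  obtain q where q: "q \<noteq> c" "T d c q" using exists_beyond by blast
  have "T c y' d" using T_exchange x y' by blast
  then have "T d y' c" using T_sym by blast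
  then have "T y' c q" using T_exchange q by blast
  then have "T q c d" "T q c y'" using q T_sym by blast+
  moreover have "E c d c y'" using y y' E_trans by blast
  ultimately have "d = y'" using ext_unique q by blast
  then have "x = d" using T_antisym x y' by blast
  then show "E a b c d" using x by simp
qed

lemma inside_iff: "inside m n e \<longleftrightarrow> len m e \<le> len m n"
  unfolding inside_def using E_sym by (metis len_le_iff)

lemma len_commute: "len a b = len b a"
  using A1 E_len by blast

lemma len_eq_0 [simp]: "len a b = len c c \<longleftrightarrow> a = b"
  using E_null_iff E_len by blast

lemma len_ge_0 [simp]: "len c c \<le> len a b"
proof -
  have "T a a b" "E c c a a" using E_null by auto
  then show ?thesis using len_le_iff by blast
qed

lemma segment_extension: assumes "q \<noteq> a" shows "\<exists>x. T q a x \<and> len a x = len b c"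
  using segment_ext assms E_len by blast

lemma len_five_segment:
  assumes "a \<noteq> b" "T a b c" "T a' b' c'" "len a b = len a' b'" "len b c = len b' c'"
    "len a d = len a' d'" "len b d = len b' d'"
  shows "len c d = len c' d'"
  using five_segment assms E_len by blast

lemma len_add:
  assumes "T a b c" "T a' b' c'" "len a b = len a' b'" "len b c = len b' c'"
  shows "len a c = len a' c'"
  using E_add assms E_len by blast

lemma extension_unique:
  assumes "q \<noteq> a" "T q a x" "T q a y" "len a x = len a y" shows "x = y"
  using ext_unique assms E_len by blast

lemma len_transport:
  assumes "T a b c" "len a c = len a' c'"
  shows "\<exists>b'. T a' b' c' \<and> len a b = len a' b' \<and> len b c = len b' c'"
  using E_transport assms E_len by meson

lemma len_linear: "len a b \<le> len c d \<or> len c d \<le> len a b"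
proof -
  obtain q where q: "q \<noteq> c" "T d c q" using exists_beyond by blast
  then obtain x where x: "T q c x" "len c x = len a b" using segment_extension by blast
  have "T q c d" using q T_sym by blast
  then have "T c x d \<or> T c d x" using T_connect2 q x by blast
  moreover have "T c x d \<Longrightarrow> len c x \<le> len c d" "T c d x \<Longrightarrow> len c d \<le> len c x"
    using len_le_iff E_refl by blast+
  ultimately show ?thesis using x by auto
qed

lemma T_len_le: assumes "T a b c" shows "len a b \<le> len a c" "len b c \<le> len a c"
proof -
  show "len a b \<le> len a c" using len_le_iff assms E_refl by blast
  have "T c b a" using assms T_sym by blast
  then have "len c b \<le> len c a" using len_le_iff E_refl by blast
  then show "len b c \<le> len a c" using len_commute by metis
qed

text \<open>Extend both segments equally beyond \<open>c\<close> and \<open>c'\<close>: the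
  five-segment axiom first gives the distances from the new end, and then, read backwards over
  \<open>c\<close>, those from \<open>b\<close>.\<close>

lemma len_inner_five_segment:
  assumes "T a b c" "T a' b' c'" "len a c = len a' c'" "len b c = len b' c'"
    "len a d = len a' d'" "len c d = len c' d'"
  shows "len b d = len b' d'"
proof (cases "a = c")
  case True
  then show ?thesis using assms by (metis T_iden len_eq_0)
next
  case False
  then have ne: "a' \<noteq> c'" using assms(3) by auto
  obtain e where e: "e \<noteq> c" "T a c e" using exists_beyond by blast
  obtain e' where e': "T a' c' e'" "len c' e' = len c e" using segment_extension ne by blast
  have "len e d = len e' d'"
    using len_five_segment[OF False e(2) e'(1) assms(3) _ assms(5,6)] e' by simp
  moreover have "e \<noteq> c" "T e c b" "T e' c' b'"
    using e e' assms T_exchange(1) T_sym by blast+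
  ultimately show ?thesis
    using len_five_segment[of e c b e' c' b' d d'] e' assms len_commute by metis
qed

text \<open>The copy \<open>d\<close> of \<open>b\<close> on \<open>a'c'\<close> has distance zero
  from \<open>b'\<close> by the inner five-segment property.\<close>

lemma T_congruent:
  assumes "T a b c" "len a b = len a' b'" "len b c = len b' c'" "len a c = len a' c'"
  shows "T a' b' c'"
proof -
  obtain d where d: "T a' d c'" "len a b = len a' d" "len b c = len d c'"
    using len_transport assms by blast
  have "len d b' = len d d"
    using len_inner_five_segment[OF d(1) d(1), of d b'] assms(2,3) d(2,3) len_commute by metis
  then have "d = b'" by simp
  then show ?thesis using d by simp
qed

lemma len_strict: assumes "T a b c" "b \<noteq> c" shows "len a b < len a c"
proof -
  have "len a b \<noteq> len a c"
  proof
    assume e: "len a b = len a c"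
    obtain q where q: "q \<noteq> a" "T c a q" using exists_beyond by blast
    have "T c b a" using assms T_sym by blast
    then have "T b a q" using q T_exchange by blast
    then show False using extension_unique[of q a b c] q e assms T_sym by blast
  qed
  then show ?thesis using T_len_le(1)[OF assms(1)] by auto
qed

lemma len_strict': assumes "T a b c" "a \<noteq> b" shows "len b c < len a c"
  using len_strict[of c b a] assms T_sym len_commute by metis

lemma len_le_point:
  assumes "len a b \<le> len c d" shows "\<exists>z. T c z d \<and> len c z = len a b"
  using assms len_le_iff E_len by auto

lemma len_not_less: "\<not> len a b < len c d \<longleftrightarrow> len c d \<le> len a b"
  using len_linear[of a b c d] by (metis order.strict_iff_not order.order_iff_strict)

lemma len_not_le: "\<not> len a b \<le> len c d \<longleftrightarrow> len c d < len a b"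
  using len_not_less by blast

section \<open>Collinearity\<close>

lemma Col_iff: "Col a b c \<longleftrightarrow> T c a b \<or> T a c b \<or> T a b c"
  unfolding Col_def by blast

lemma Col_triv [simp]: "Col a b a" "Col a b b" "Col a a b"
  by (auto simp: Col_iff)

lemma Col_swap: "Col a b c \<longleftrightarrow> Col b a c" "Col a b c \<longleftrightarrow> Col a c b"
  using T_sym by (auto simp: Col_iff)

lemma Col_trans: assumes "a \<noteq> b" "Col a b c" "Col a b d" shows "Col a c d"
proof -
  have *: "Col a c d" if "T c a b" "T a d b \<or> T a b d" for c d
    using that T_outer(2)[of c a b d] T_exchange(1)[of b d a c] assms(1) T_sym
    unfolding Col_iff by metis
  show ?thesis
    using assms(2,3) * T_connect2[of b a c d] T_connect3[of a c b d] T_connect[of a b c d]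
      T_exchange(2)[of a c b d] T_exchange(2)[of a d b c] assms(1) T_sym Col_swap
    unfolding Col_iff by metis
qed

subsection \<open>Lines, circles and perpendiculars\<close>

definition ln :: "'p \<Rightarrow> 'p \<Rightarrow> 'p set" where
  "ln a b = {x. Col a b x}"

definition is_line :: "'p set \<Rightarrow> bool" where
  "is_line L \<longleftrightarrow> (\<exists>a b. a \<noteq> b \<and> L = ln a b)"

lemma ln_mem [simp]: "a \<in> ln a b" "b \<in> ln a b" by (auto simp: ln_def)

lemma ln_commute: "ln a b = ln b a" using Col_swap by (auto simp: ln_def)

lemma is_line_ln [intro]: "a \<noteq> b \<Longrightarrow> is_line (ln a b)" unfolding is_line_def by blast

lemma line_eq_ln: assumes "is_line L" "p \<in> L" "q \<in> L" "p \<noteq> q" shows "L = ln p q"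
proof -
  have *: "ln a b = ln a p" if "a \<noteq> b" "p \<in> ln a b" "p \<noteq> a" for a b p
  proof -
    have "Col a b x \<longleftrightarrow> Col a p x" for x
      using that Col_trans[of a b p x] Col_trans[of a p b x] Col_swap unfolding ln_def by blast
    then show ?thesis unfolding ln_def by blast
  qed
  have **: "ln a b = ln p q" if "a \<noteq> b" "p \<in> ln a b" "q \<in> ln a b" "p \<noteq> q" "p \<noteq> a" for a b p q
    using *[of a b p] *[of p a q] that ln_commute by metis
  obtain a b where ab: "a \<noteq> b" "L = ln a b" using assms(1) unfolding is_line_def by blast
  show ?thesis
    using **[of a b p q] **[of a b q p] ab assms ln_commute by metis
qed

lemma lines_meet_once:
  "is_line L \<Longrightarrow> is_line L' \<Longrightarrow> p \<in> L \<Longrightarrow> q \<in> L \<Longrightarrow> p \<in> L' \<Longrightarrow> q \<in> L' \<Longrightarrow> p \<noteq> q \<Longrightarrow> L = L'"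
  using line_eq_ln by metis

lemma T_line:
  assumes "is_line L" "T a b c"
  shows "a \<in> L \<Longrightarrow> b \<in> L \<Longrightarrow> a \<noteq> b \<Longrightarrow> c \<in> L" "a \<in> L \<Longrightarrow> c \<in> L \<Longrightarrow> b \<in> L"
    "c \<in> L \<Longrightarrow> b \<in> L \<Longrightarrow> b \<noteq> c \<Longrightarrow> a \<in> L"
proof -
  show "a \<in> L \<Longrightarrow> b \<in> L \<Longrightarrow> a \<noteq> b \<Longrightarrow> c \<in> L"
    using line_eq_ln[OF assms(1)] assms(2) unfolding ln_def Col_iff by blast
  show "c \<in> L \<Longrightarrow> b \<in> L \<Longrightarrow> b \<noteq> c \<Longrightarrow> a \<in> L"
    using line_eq_ln[OF assms(1)] assms(2) unfolding ln_def Col_iff by blast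
  show "a \<in> L \<Longrightarrow> c \<in> L \<Longrightarrow> b \<in> L"
    using line_eq_ln[OF assms(1), of a c] assms(2) unfolding ln_def Col_iff
    by (cases "a = c") auto
qed

lemma exists_not_Col: assumes "a \<noteq> b" shows "\<exists>c. \<not> Col a b c"
proof (rule ccontr)
  assume "\<not> ?thesis"
  then have *: "\<alpha> \<in> ln a b" "\<beta> \<in> ln a b" "\<gamma> \<in> ln a b" unfolding ln_def by blast+
  have "\<alpha> \<noteq> \<beta>" using A8 Col_triv by metis
  then have "ln a b = ln \<alpha> \<beta>" using line_eq_ln assms * by blast
  then show False using * A8 unfolding ln_def by blast
qed

lemma Col_five_segment:
  assumes "Col a b c" "a \<noteq> b" "len a b = len a' b'" "len b c = len b' c'" "len a c = len a' c'"
    "len a d = len a' d'" "len b d = len b' d'"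
  shows "len c d = len c' d'"
proof -
  consider "T a b c" | "T a c b" | "T b a c" using assms(1) T_sym Col_iff by blast
  then show ?thesis
  proof cases
    case 1
    then have "T a' b' c'" using T_congruent assms by blast
    then show ?thesis using len_five_segment assms 1 by blast
  next
    case 2
    have "T a' c' b'" by (rule T_congruent[OF 2]) (use assms in \<open>simp_all add: len_commute\<close>)
    then show ?thesis
      by (rule len_inner_five_segment[OF 2]) (use assms in \<open>simp_all add: len_commute\<close>)
  next
    case 3
    have "T b' a' c'" by (rule T_congruent[OF 3]) (use assms in \<open>simp_all add: len_commute\<close>)
    then show ?thesis
      by (rule len_five_segment[OF assms(2)[symmetric] 3])
        (use assms in \<open>simp_all add: len_commute\<close>)
  qed
qed

lemma Col_equidistant:
  assumes "a \<noteq> b" "Col a b c" "len a p = len a q" "len b p = len b q" shows "len c p = len c q"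
  using Col_five_segment assms by blast

lemma exists_on_ray: assumes "c \<noteq> p" shows "\<exists>b. (T c p b \<or> T c b p) \<and> len c b = len d e"
proof -
  obtain q where q: "q \<noteq> c" "T p c q" using exists_beyond by blast
  then obtain b where "T q c b" "len c b = len d e" using segment_extension by blast
  then show ?thesis using T_connect2 q T_sym by blast
qed

lemma T_of_len: assumes "T c p b \<or> T c b p" "len c p \<le> len c b" shows "T c p b"
proof (cases "T c p b")
  case False
  then have t: "T c b p" using assms by blast
  then have "b = p" using len_strict[OF t] assms(2) by (auto simp: len_not_less[symmetric])
  then show ?thesis by simp
qed

lemma on_ray_unique: assumes "T c p b \<or> T c b p" "len c p = len c b" shows "p = b"
  using T_of_len[of c p b] T_of_len[of c b p] assms T_antisym by auto

text \<open>The two-point axiom wants \<open>p\<close> on the segment from the center to the given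
  point of the circle. As \<open>d\<close> is arbitrary, it is replaced by the point
  \<open>b\<close> at the same distance on the ray from \<open>c\<close> through
  \<open>p\<close>.\<close>

lemma line_meets_circle:
  assumes "is_line L" "p \<in> L" "len c p \<le> len c d"
  obtains y z where "y \<in> L" "z \<in> L" "len c y = len c d" "len c z = len c d" "T y p z"
    "\<And>w. w \<in> L \<Longrightarrow> len c w = len c d \<Longrightarrow> w = y \<or> w = z"
proof -
  obtain u v where uv: "u \<noteq> v" "L = ln u v" using assms(1) unfolding is_line_def by blast
  obtain b where b: "T c p b" "len c b = len c d"
  proof (cases "p = c")
    case True then show ?thesis using that[of d] by simp
  next
    case False
    then obtain b where b: "T c p b \<or> T c b p" "len c b = len c d" using exists_on_ray by metis
    then show ?thesis using that T_of_len assms by metis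
  qed
  have Lp: "Col u v p" using assms(2) uv unfolding ln_def by blast
  have i: "ilc_defined u v c b"
    unfolding ilc_defined_def inside_def using uv Lp b E_refl by blast
  let ?y = "ilc\<^sub>1 u v c b" and ?z = "ilc\<^sub>2 u v c b"
  have 1: "Col u v ?y" "Col u v ?z" "E c ?y c b" "E c ?z c b"
     "\<And>w. Col u v w \<Longrightarrow> E c w c b \<Longrightarrow> w = ?y \<or> w = ?z"
    using line_circle[OF refl refl, of u v c b] i by blast+
  have 2: "T ?y p ?z" using line_circle_two_points[OF refl refl, of u v p c b] uv Lp b by blast
  show thesis
  proof (rule that[OF _ _ _ _ 2])
    show "?y \<in> L" "?z \<in> L" using 1 uv unfolding ln_def by blast+
    show "len c ?y = len c d" "len c ?z = len c d" using 1(3,4) E_len b by metis+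
    show "w = ?y \<or> w = ?z" if "w \<in> L" "len c w = len c d" for w
      using 1(5) that uv b E_len unfolding ln_def by auto
  qed
qed

text \<open>If \<open>x\<close> were on the circle or outside, it would be an end of a chord through \<open>p\<close> and \<open>q\<close> of the
  circle through \<open>x\<close>.\<close>

lemma disc_strictly_convex:
  assumes t: "T p x q" "x \<noteq> p" "x \<noteq> q" and le: "len c p \<le> len c q"
  shows "len c x < len c q"
proof (rule ccontr)
  assume "\<not> ?thesis"
  then have q: "len c q \<le> len c x" by (simp add: len_not_less)
  then have p: "len c p \<le> len c x" using le by order
  have "p \<noteq> q" using t by auto
  then have L: "is_line (ln p q)" by blast
  have xL: "x \<in> ln p q" using t T_line(2)[OF L t(1)] by simp
  obtain y z where yz: "y \<in> ln p q" "z \<in> ln p q" "len c y = len c x" "len c z = len c x" "T y p z"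
     "\<And>w. w \<in> ln p q \<Longrightarrow> len c w = len c x \<Longrightarrow> w = y \<or> w = z"
    by (rule line_meets_circle[OF L _ p]) auto
  obtain y' z' where yz': "y' \<in> ln p q" "z' \<in> ln p q" "len c y' = len c x" "len c z' = len c x" "T y' q z'"
     "\<And>w. w \<in> ln p q \<Longrightarrow> len c w = len c x \<Longrightarrow> w = y' \<or> w = z'"
    by (rule line_meets_circle[OF L _ q]) auto
  have "T y q z" using yz yz' T_sym by metis
  moreover have "x = y \<or> x = z" using yz xL by blast
  ultimately obtain w where "T x p w" "T x q w" using yz T_sym by blast
  then have "T x p q \<or> T x q p" using T_connect3 by blast
  then show False using t T_antisym2 T_sym by metis
qed

lemma disc_convex:
  assumes "T p x q" "len c p \<le> len d e" "len c q \<le> len d e" shows "len c x \<le> len d e"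
proof (cases "x = p \<or> x = q")
  case False
  then have "len c x < len c q \<or> len c x < len c p"
    using disc_strictly_convex[of p x q c] disc_strictly_convex[of q x p c] assms(1) T_sym
      len_linear[of c p c q] by blast
  then show ?thesis using assms by (auto intro: order.trans order.strict_implies_order)
qed (use assms in auto)

lemma disc_convex':
  assumes "T p x q" "len c p < len d e" "len c q < len d e" shows "len c x < len d e"
  using disc_convex[OF assms(1), of c c p] disc_convex[OF assms(1), of c c q]
    len_linear[of c p c q] assms by (meson order.refl order.strict_trans1)

text \<open>Both longer pieces are cut back from their common point \<open>b'\<close>, which leaves
  a subsegment congruent to \<open>ac\<close>.\<close>

lemma len_sum_mono:
  assumes "T a b c" "T a' b' c'" "len a b \<le> len a' b'" "len b c \<le> len b' c'"
  shows "len a c \<le> len a' c'"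
proof -
  obtain z where z: "T b' z c'" "len b' z = len b c" using len_le_point assms by blast
  obtain w where w: "T b' w a'" "len b' w = len b a" using len_le_point assms len_commute by metis
  have t: "T w b' c'" "T a' w c'" using w assms(2) T_exchange T_sym by blast+
  have t2: "T w b' z" "T w z c'" using t z T_exchange T_sym by blast+
  have "len a c = len w z" by (rule len_add[OF assms(1) t2(1)]) (use z w in \<open>simp_all add: len_commute\<close>)
  also have "\<dots> \<le> len w c'" using t2 T_len_le by blast
  also have "\<dots> \<le> len a' c'" using t T_len_le by blast
  finally show ?thesis .
qed

lemma Col_triangle_inequality:
  assumes "T p q r" "Col a x b" "len a x \<le> len p q" "len x b \<le> len q r"
  shows "len a b \<le> len p r"
proof -
  have "len p q \<le> len p r" "len q r \<le> len p r" using T_len_le[OF assms(1)] by auto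
  then show ?thesis
    using assms len_sum_mono[OF _ assms(1), of a x b] T_len_le[of a b x] T_len_le[of x a b] T_sym
    unfolding Col_iff by (meson order.trans)
qed

text \<open>The half-turn about \<open>m\<close>. A4 says nothing about an extension in a direction
  given by equal points, so the center is fixed by a separate case.\<close>

definition S :: "'p \<Rightarrow> 'p \<Rightarrow> 'p" where
  "S m a = (if a = m then m else ext a m m a)"

lemma S_self [simp]: "S m m = m" by (simp add: S_def)

lemma S_spec: "T a m (S m a)" "len m (S m a) = len m a"
  using A4[OF refl, of a m m a] E_len by (auto simp: S_def)

lemma S_unique: assumes "T a m b" "len m b = len m a" shows "b = S m a"
  using extension_unique[of a m b "S m a"] S_spec(1)[of a m] S_spec(2)[of m a] assms
  by (cases "a = m") auto

lemma S_S [simp]: "S m (S m a) = a"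
  using S_unique[of "S m a" m a] S_spec(1)[of a m] S_spec(2)[of m a] T_sym by metis

lemma S_eq_iff [simp]: "S m a = m \<longleftrightarrow> a = m" "S m a = a \<longleftrightarrow> a = m"
  using S_spec(1)[of a m] by (metis S_self S_S, metis S_self T_iden)

text \<open>Prolong \<open>mp\<close> by \<open>mq\<close> and \<open>mq\<close> by
  \<open>mp\<close>, and likewise for the images: the four ends \<open>x\<close>, \<open>y\<close>,
  \<open>x'\<close>, \<open>y'\<close> are equally far from \<open>m\<close>. The five-segment axiom
  across \<open>m\<close> compares the ends; its inner form, used twice, replaces them by
  \<open>q\<close> and then by \<open>p\<close>.\<close>

lemma S_isometry: "len (S m p) (S m q) = len p q"
proof (cases "p = m \<or> q = m")
  case True then show ?thesis using S_spec len_commute S_self by metis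
next
  case False
  let ?p = "S m p" and ?q = "S m q"
  have *: "\<exists>x. T (S m p) p x \<and> len p x = len m q \<and> T m p x \<and> T x p m" if "p \<noteq> m" for p q
  proof -
    have "S m p \<noteq> p" using that by simp
    then obtain x where "T (S m p) p x" "len p x = len m q" using segment_extension by blast
    then show ?thesis using S_spec(1)[of p m] T_exchange T_sym by blast
  qed
  obtain x where x: "len p x = len m q" "T m p x" "T x p m" using *[of p] False by blast
  obtain y where y: "len q y = len m p" "T m q y" "T y q m" using *[of q] False by blast
  obtain x' where x': "len ?p x' = len m q" "T m ?p x'" "T x' ?p m"
    using *[of ?p] False by auto
  obtain y' where y': "len ?q y' = len m p" "T m ?q y'" "T y' ?q m"
    using *[of ?q] False by auto
  have **: "T x m x'" if "T m p x" "T m (S m p) x'" "p \<noteq> m" for p x x'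
  proof -
    have "T p m x'" using T_outer[of p m "S m p" x'] S_spec(1)[of p m] that by (metis S_eq_iff(1))
    then show ?thesis using T_outer[of x p m x'] that T_sym by blast
  qed
  have t: "T x m x'" "T y' m y" using ** x x' y y' False T_sym by blast+
  have l1: "len m x = len y m" by (rule len_add[OF x(2) y(3)]) (use x y in \<open>simp_all add: len_commute\<close>)
  have l2: "len m x = len m x'"
    by (rule len_add[OF x(2) x'(2)]) (use x x' S_spec(2)[of m p] in simp_all)
  have l3: "len m y = len m y'"
    by (rule len_add[OF y(2) y'(2)]) (use y y' S_spec(2)[of m q] in simp_all)
  have "x \<noteq> m" using x False T_iden by metis
  then have l4: "len x' y' = len y x"
    by (rule len_five_segment[OF _ t]) (use l1 l2 l3 in \<open>simp_all add: len_commute\<close>)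
  have l5: "len q x = len ?q x'"
    by (rule len_inner_five_segment[OF y(3) y'(3)])
      (use l1 l2 l3 l4 S_spec(2)[of m q] in \<open>simp_all add: len_commute\<close>)
  have "len p q = len ?p ?q"
    by (rule len_inner_five_segment[OF x(3) x'(3)])
      (use l2 l5 S_spec(2)[of m p] S_spec(2)[of m q] in \<open>simp_all add: len_commute\<close>)
  then show ?thesis by simp
qed

lemma Col_equidistant_T: assumes "Col a b m" "len m a = len m b" "a \<noteq> b" shows "T a m b"
proof -
  have "T m a b \<Longrightarrow> a = b" "T m b a \<Longrightarrow> a = b"
    using len_strict[of m a b] len_strict[of m b a] assms by auto
  then show ?thesis using assms T_sym unfolding Col_iff by blast
qed

text \<open>Prolong the legs equally to \<open>p\<close> and \<open>q\<close>. The segments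
  \<open>aq\<close> and \<open>bp\<close> cross at a point \<open>r\<close>, equidistant from
  \<open>a\<close> and \<open>b\<close> by symmetry. The line \<open>o'r\<close> meets
  \<open>ab\<close> by inner Pasch, and equidistance passes to the whole line
  \<open>o'r\<close>.\<close>

lemma isosceles_midpoint:
  assumes "len o' a = len o' b" "\<not> Col a b o'" shows "\<exists>m. T a m b \<and> len m a = len m b"
proof -
  have ne: "a \<noteq> b" "o' \<noteq> a" "o' \<noteq> b" using assms(2) by auto
  obtain p where p: "p \<noteq> a" "T o' a p" using exists_beyond by blast
  obtain q where q: "T o' b q" "len b q = len a p" using segment_extension ne by blast
  have qb: "q \<noteq> b" using p q len_eq_0 by metis
  have "o' \<noteq> p" "o' \<noteq> q" using p q ne by auto
  let ?L = "ln a b"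
  have "p \<in> ln o' a" "q \<in> ln o' b" using p q by (simp_all add: ln_def Col_iff)
  then have L1: "ln o' a = ln o' p" "ln o' b = ln o' q"
    using line_eq_ln[OF is_line_ln ln_mem(1)] ne \<open>o' \<noteq> p\<close> \<open>o' \<noteq> q\<close> by metis+
  have "b \<notin> ln o' a" using assms(2) Col_swap unfolding ln_def by blast
  then have L0: "ln o' a \<noteq> ln o' b" by auto
  have n1: "\<not> Col p q o'"
  proof
    assume c: "Col p q o'"
    then have "q \<in> ln o' p" using Col_swap unfolding ln_def by blast
    then have "ln o' p = ln o' q" by (intro line_eq_ln) (use \<open>o' \<noteq> p\<close> \<open>o' \<noteq> q\<close> in auto)
    then show False using L1 L0 by simp
  qed
  have n2: "\<not> Col o' b p"
  proof
    assume "Col o' b p"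
    then have "p \<in> ln o' b" unfolding ln_def by blast
    then have "ln o' b = ln o' p" by (intro line_eq_ln) (use \<open>o' \<noteq> p\<close> ne in auto)
    then show False using L1 L0 by simp
  qed
  have b1: "B p a o'" "B q b o'" "B o' a p" using p q qb ne T_sym B_iff by metis+
  obtain r where r: "B a r q" "B b r p" using A7[OF refl, of p a o' q b] b1 n1 by blast
  obtain x where x: "B a x b" "B r x o'" using A7[OF refl, of o' a p b r] b1 r n2 by blast
  have pb: "len p b = len q a"
    by (rule len_five_segment[OF ne(2) p(2) q(1)]) (use assms q in \<open>simp_all add: len_commute\<close>)
  have rT: "T b r p" "T a r q" using r B_iff by blast+
  \<comment> \<open>The image of \<open>r\<close> under the symmetry exchanging \<open>a\<close>
    with \<open>b\<close> and \<open>p\<close> with \<open>q\<close>. It lies on both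
    \<open>aq\<close> and \<open>bp\<close>, so it is \<open>r\<close> itself.\<close>
  obtain r' where r': "T a r' q" "len b r = len a r'" "len r p = len r' q"
    using len_transport[OF rT(1), of a q] pb len_commute[of b p] len_commute[of q a] by auto
  have ra: "len r a = len r' b"
    by (rule len_inner_five_segment[OF rT(1) r'(1)]) (use pb r' q in \<open>simp_all add: len_commute\<close>)
  have rq: "len r q = len r' p"
    by (rule len_inner_five_segment[OF rT(1) r'(1)]) (use pb r' q in \<open>simp_all add: len_commute\<close>)
  have r'T: "T b r' p" by (rule T_congruent[OF rT(2)]) (use ra rq pb in \<open>simp_all add: len_commute\<close>)
  have aq: "a \<noteq> q" "b \<noteq> p" using r B_distinct by blast+
  have "r = r'"
  proof (rule ccontr)
    assume "r \<noteq> r'"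
    moreover have "r \<in> ln a q" "r' \<in> ln a q" "r \<in> ln b p" "r' \<in> ln b p"
      using rT r' r'T unfolding ln_def Col_iff by blast+
    ultimately have e: "ln a q = ln b p" using lines_meet_once aq is_line_ln by blast
    then have "b \<in> ln a q" "p \<in> ln a q" by simp_all
    then have "ln a q = ln a b" using line_eq_ln[of "ln a q" a b] aq ne is_line_ln ln_mem by blast
    then have "p \<in> ln a b" using \<open>p \<in> ln a q\<close> by simp
    then have "o' \<in> ln a b"
      using T_line(3)[OF is_line_ln[OF ne(1)] p(2)] p(1) ln_mem by blast
    then show False using assms(2) unfolding ln_def by blast
  qed
  then have "len r a = len r b" using ra by simp
  moreover have "r \<noteq> o'" "Col r o' x" using x B_distinct B_iff unfolding Col_iff by blast+
  ultimately have "len x a = len x b" using Col_equidistant assms by blast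
  then show ?thesis using x B_iff by blast
qed

text \<open>The center of a circle through \<open>a\<close>, \<open>b\<close> and a point off their
  line is equidistant from \<open>a\<close> and \<open>b\<close>: it is the midpoint if collinear
  with them, otherwise the apex of an isosceles triangle.\<close>

lemma exists_midpoint: "\<exists>m. T a m b \<and> len m a = len m b"
proof (cases "a = b")
  case False
  obtain w where w: "\<not> Col a b w" using exists_not_Col False by blast
  then have "E a (center a b w) b (center a b w)" using A10[OF refl] by blast
  then have "len (center a b w) a = len (center a b w) b" using E_len len_commute by metis
  then show ?thesis using isosceles_midpoint Col_equidistant_T False by blast
qed auto

text \<open>The foot of the perpendicular. The right angle is expressed by the half-turn about
  \<open>f\<close>, which must preserve the distance from \<open>c\<close> on the whole
  line.\<close>

definition foot :: "'p set \<Rightarrow> 'p \<Rightarrow> 'p \<Rightarrow> bool" where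
  "foot L c f \<longleftrightarrow> f \<in> L \<and> (\<forall>x\<in>L. len c (S f x) = len c x)"

lemma S_line: "is_line L \<Longrightarrow> m \<in> L \<Longrightarrow> a \<in> L \<Longrightarrow> S m a \<in> L"
  using T_line(1)[of L a m "S m a"] S_spec(1) by (cases "a = m") auto

text \<open>The half-turn about \<open>f\<close> exchanges \<open>y\<close> and \<open>z\<close>, so
  the five-segment property carries \<open>cy = cz\<close> over to every point of the line and its
  image.\<close>

lemma equidistant_foot:
  assumes "is_line L" "y \<in> L" "z \<in> L" "y \<noteq> z" "len c y = len c z" "T y f z" "len f y = len f z"
  shows "foot L c f"
proof -
  have fL: "f \<in> L" using T_line assms by blast
  have z: "z = S f y" using S_unique assms by metis
  have ne: "f \<noteq> y" using assms(4) z by auto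
  have "len c (S f x) = len c x" if "x \<in> L" for x
  proof -
    have "Col f y x" using line_eq_ln[OF assms(1) fL assms(2) ne] that unfolding ln_def by blast
    moreover have "len f x = len f (S f x)" "len y x = len z (S f x)" "len f c = len f c"
      using S_spec(2)[of f x] S_isometry[of f y x] z by simp_all
    moreover have "len f y = len f z" "len y c = len z c" using assms by (simp_all add: len_commute)
    ultimately have "len x c = len (S f x) c"
      using Col_five_segment[of f y x f z "S f x" c c] ne by blast
    then show ?thesis using len_commute by metis
  qed
  then show ?thesis using fL unfolding foot_def by blast
qed

text \<open>Of two points of the line, take the circle about \<open>c\<close> through the farther
  one. The nearer one lies on its chord, so the chord is not degenerate, and its midpoint is the
  foot.\<close>

lemma exists_foot: assumes "is_line L" shows "\<exists>f. foot L c f"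
proof -
  obtain u v where uv: "u \<noteq> v" "L = ln u v" using assms unfolding is_line_def by blast
  have *: "\<exists>f. foot L c f" if le: "len c u \<le> len c v" and uv: "u \<in> L" "v \<in> L" "u \<noteq> v" for u v
  proof -
    obtain y z where yz: "y \<in> L" "z \<in> L" "len c y = len c v" "len c z = len c v" "T y u z"
      "\<And>w. w \<in> L \<Longrightarrow> len c w = len c v \<Longrightarrow> w = y \<or> w = z"
      using line_meets_circle[OF assms uv(1) le] by blast
    have "y \<noteq> z" using yz uv T_iden by metis
    moreover obtain m where "T y m z" "len m y = len m z" using exists_midpoint by blast
    ultimately show ?thesis using equidistant_foot[OF assms yz(1,2)] yz by metis
  qed
  show ?thesis using *[of u v] *[of v u] len_linear[of c u c v] uv by auto
qed

text \<open>The foot is strictly between \<open>x\<close> and \<open>S f x\<close>, which are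
  equally far from \<open>c\<close>; discs are strictly convex.\<close>

lemma foot_less: assumes "foot L c f" "x \<in> L" "x \<noteq> f" shows "len c f < len c x"
proof -
  have "len c x = len c (S f x)" using assms unfolding foot_def by auto
  moreover have "f \<noteq> S f x" using assms by (metis S_eq_iff(1))
  ultimately show ?thesis
    using disc_strictly_convex[OF S_spec(1), of f x c] assms by auto
qed

lemma foot_le: assumes "foot L c f" "x \<in> L" shows "len c f \<le> len c x"
  using foot_less assms by (cases "x = f") (auto intro: order.strict_implies_order)

text \<open>As for the other leg, but with \<open>c\<close> turned about the foot: \<open>c\<close>
  and \<open>S f c\<close> are equally far from \<open>x\<close>.\<close>

lemma foot_other_leg: assumes "foot L c f" "x \<in> L" shows "len x f \<le> len x c"
proof (cases "c = f")
  case False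
  have "len (S f x) (S f c) = len (S f x) c"
    using assms S_isometry[of f x c] len_commute unfolding foot_def by metis
  then have "len x c = len x (S f c)" using S_isometry[of f x] S_isometry[of f "S f x" c] by simp
  moreover have "f \<noteq> S f c" using False by (metis S_eq_iff(1))
  ultimately have "len x f < len x c"
    using disc_strictly_convex[OF S_spec(1), of f c x] False by auto
  then show ?thesis by simp
qed simp

text \<open>Replace \<open>x\<close> by its foot on the line \<open>ab\<close>: neither distance
  grows, and three collinear points remain. The sum of the two bounds is represented by the segment
  \<open>pr\<close> divided at \<open>q\<close>.\<close>

lemma triangle_inequality:
  assumes "T p q r" "len a x \<le> len p q" "len x b \<le> len q r" shows "len a b \<le> len p r"
proof (cases "a = b")
  case False
  then obtain f where f: "foot (ln a b) x f" using exists_foot by blast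
  have "len a f \<le> len p q" "len f b \<le> len q r"
    using foot_other_leg[OF f] assms len_commute by (metis ln_mem order.trans)+
  moreover have "Col a f b" using f Col_swap unfolding foot_def ln_def by blast
  ultimately show ?thesis using Col_triangle_inequality assms by blast
qed simp

lemma T_S: assumes "T a b c" shows "T (S m a) (S m b) (S m c)"
  by (rule T_congruent[OF assms]) (simp_all add: S_isometry)

lemma S_conj: "S n (S f y) = S (S n f) (S n y)"
proof (rule S_unique)
  show "T (S n y) (S n f) (S n (S f y))" using T_S S_spec(1) by blast
  show "len (S n f) (S n (S f y)) = len (S n f) (S n y)" by (simp add: S_isometry S_spec(2))
qed

lemma midpoint_unique:
  assumes "T a m b" "len m a = len m b" "T a n b" "len n a = len n b" shows "m = n"
proof -
  have *: "m = n" if "T a m b" "len m a = len m b" "T a n b" "len n a = len n b" "T a m n" for m n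
  proof -
    have "T n m a" "T b n a" using that T_sym by blast+
    then have "T b n m" "T b m a" using T_inner that T_sym by blast+
    then have "len b n \<le> len b m" using T_len_le by blast
    then have "len a n \<le> len a m" using that by (simp add: len_commute)
    then show ?thesis using T_antisym[of a m n] T_of_len[of a n m] that by blast
  qed
  then show ?thesis using T_connect3[OF assms(1,3)] assms by metis
qed

lemma Col_congruent:
  assumes "Col a b c" "len a b = len a' b'" "len b c = len b' c'" "len a c = len a' c'"
  shows "Col a' b' c'"
proof -
  consider "T c a b" | "T a c b" | "T a b c" using assms(1) Col_iff by blast
  then show ?thesis
  proof cases
    case 1
    have "T c' a' b'" by (rule T_congruent[OF 1]) (use assms in \<open>simp_all add: len_commute\<close>)
    then show ?thesis by (simp add: Col_iff)
  next
    case 2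
    have "T a' c' b'" by (rule T_congruent[OF 2]) (use assms in \<open>simp_all add: len_commute\<close>)
    then show ?thesis by (simp add: Col_iff)
  next
    case 3
    have "T a' b' c'" by (rule T_congruent[OF 3]) (use assms in \<open>simp_all add: len_commute\<close>)
    then show ?thesis by (simp add: Col_iff)
  qed
qed

subsection \<open>Sides of a line\<close>

definition ray :: "'p \<Rightarrow> 'p \<Rightarrow> 'p \<Rightarrow> bool" where
  "ray r a b \<longleftrightarrow> a \<noteq> r \<and> b \<noteq> r \<and> (T r a b \<or> T r b a)"

lemma ray_sym: "ray r a b \<Longrightarrow> ray r b a" unfolding ray_def by blast

lemma ray_trans: assumes "ray r a b" "ray r b c" shows "ray r a c"
  using assms T_exchange(2)[of r] T_connect[of r b a c] T_connect3[of r a b c] unfolding ray_def by blast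

lemma ray_opposite: assumes "T a r b" "T a r c" "a \<noteq> r" "b \<noteq> r" "c \<noteq> r" shows "ray r b c"
  using T_connect2[of a r b c] assms unfolding ray_def by blast

lemma ray_notin: assumes "is_line L" "r \<in> L" "ray r a b" "a \<notin> L" shows "b \<notin> L"
  using T_line[OF assms(1), of r] assms unfolding ray_def by blast

definition opp :: "'p set \<Rightarrow> 'p \<Rightarrow> 'p \<Rightarrow> bool" where
  "opp L a b \<longleftrightarrow> a \<notin> L \<and> b \<notin> L \<and> (\<exists>t\<in>L. T a t b)"

lemma opp_sym: "opp L a b \<Longrightarrow> opp L b a" unfolding opp_def using T_sym by blast

lemma opp_irrefl: "\<not> opp L a a" unfolding opp_def by auto

text \<open>Inner Pasch in the triangle \<open>r a c\<close>: \<open>bc\<close> crosses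
  \<open>tr\<close>, a part of the line. The positions \<open>b = a\<close> and
  \<open>t = r\<close>, where the triangle argument degenerates, are treated apart.\<close>

lemma opp_inner:
  assumes L: "is_line L" and o: "opp L a c" and r: "r \<in> L" "T r b a" "b \<noteq> r"
  shows "opp L b c"
proof -
  obtain t where t: "t \<in> L" "T a t c" and n: "a \<notin> L" "c \<notin> L" using o unfolding opp_def by blast
  have b: "b \<notin> L" using T_line(1)[OF L r(2)] r n by blast
  show ?thesis
  proof (cases "b = a \<or> t = r")
    case True
    have "T b t c" if "t = r"
    proof -
      have "T c t a" "T t b a" using that t r T_sym by blast+
      then have "T c t b" using T_inner by blast
      then show ?thesis using T_sym by blast
    qed
    then show ?thesis using True o b t n unfolding opp_def by blast
  next
    case False
    have "\<not> Col r c a"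
    proof
      assume "Col r c a"
      moreover have "a \<noteq> c" using opp_irrefl o by blast
      ultimately have ac: "is_line (ln a c)" by blast
      have "Col a c r" using \<open>Col r c a\<close> Col_swap by blast
      then have "r \<in> ln a c" "t \<in> ln a c" using t by (simp_all add: ln_def Col_iff)
      then have "L = ln a c" using lines_meet_once[OF L ac] r t False by blast
      then show False using n by simp
    qed
    moreover have "B r b a" "B c t a" using False r t n T_sym B_iff by metis+
    ultimately obtain x where x: "B b x c" "B t x r" using A7[OF refl, of r b a c t] by blast
    then have "x \<in> L" using T_line(2)[OF L] t r B_iff by blast
    then show ?thesis using b n x B_iff unfolding opp_def by blast
  qed
qed

text \<open>If \<open>b\<close> is beyond \<open>a\<close>, the half-turn about \<open>m\<close>
  brings in an inner position: \<open>S m a\<close> is between \<open>S m r\<close> and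
  \<open>S m b\<close>, so A7 applies in the triangle with corners \<open>b\<close>,
  \<open>S m b\<close> and \<open>S m r\<close>.\<close>

lemma opp_S_ray:
  assumes L: "is_line L" and m: "m \<in> L" and r: "r \<in> L" and a: "a \<notin> L" and ab: "ray r a b"
  shows "opp L b (S m a)"
proof -
  have c: "S m a \<notin> L" using S_line[OF L m, of "S m a"] a by auto
  have am: "T a m (S m a)" using S_spec by blast
  have o: "opp L a (S m a)" using a c m am unfolding opp_def by blast
  have b: "b \<notin> L" using ray_notin L r ab a by blast
  consider "T r b a" | "T r a b" "r = m" | "T r a b" "r \<noteq> m" "a \<noteq> b" | "a = b" using ab unfolding ray_def by blast
  then show ?thesis
  proof cases
    case 1
    then show ?thesis using opp_inner[OF L o r] ab unfolding ray_def by blast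
  next
    case 2
    have "T (S m a) m b" using T_outer(2)[of "S m a" m a b] am 2 T_sym a m by blast
    then show ?thesis using b c m T_sym unfolding opp_def by blast
  next
    case 3
    let ?r = "S m r" and ?b = "S m b" and ?c = "S m a"
    have rL: "?r \<in> L" using S_line[OF L m r] .
    have bb: "T b m ?b" using S_spec by blast
    have bm: "b \<noteq> m" "?b \<noteq> m" using b m by auto
    have "T ?r ?c ?b" using T_S 3 by blast
    moreover have "?r \<noteq> ?c" using rL c by metis
    moreover have "?c \<noteq> ?b" using 3(3) by (metis S_S)
    ultimately have 1: "B ?r ?c ?b" using B_iff by blast
    have 2: "B b m ?b" using bb bm B_iff by metis
    have "\<not> Col b ?r ?b"
    proof
      assume "Col b ?r ?b"
      moreover have "b \<noteq> ?b" using bm by (metis S_eq_iff(2))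
      ultimately have ac: "is_line (ln b ?b)" by blast
      have "Col b ?b ?r" using \<open>Col b ?r ?b\<close> Col_swap by blast
      then have "?r \<in> ln b ?b" "m \<in> ln b ?b" using bb by (simp_all add: ln_def Col_iff)
      moreover have "?r \<noteq> m" using 3(2) by simp
      ultimately have "L = ln b ?b" using lines_meet_once[OF L ac] rL m by blast
      then show False using b by simp
    qed
    then obtain x where x: "B m x ?r" "B ?c x b" using A7[OF refl, of b m ?b ?r ?c] 1 2 by blast
    then have "x \<in> L" using T_line(2)[OF L] m rL B_iff by blast
    then show ?thesis using b c x B_iff T_sym unfolding opp_def by blast
  next
    case 4 then show ?thesis using o by simp
  qed
qed

section \<open>Perpendiculars and the sides of a line\<close>

lemma foot_notin: "foot L c f \<Longrightarrow> c \<notin> L \<Longrightarrow> c \<noteq> f" unfolding foot_def by blast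

lemma is_line_other: assumes "is_line L" shows "\<exists>u\<in>L. u \<noteq> f"
proof -
  obtain a b where "a \<noteq> b" "L = ln a b" using assms unfolding is_line_def by blast
  then show ?thesis using ln_mem by metis
qed

text \<open>All three points are equidistant from \<open>u\<close> and \<open>S f u\<close>, so the
  dimension axiom A9 puts them on one line.\<close>

lemma foot_Col: assumes "is_line L" "foot L a f" "foot L b f" shows "Col a b f"
proof -
  obtain u where u: "u \<in> L" "u \<noteq> f" using is_line_other assms by blast
  then have "u \<noteq> S f u" by (metis S_eq_iff(2))
  moreover have "len a u = len a (S f u)" "len b u = len b (S f u)" "len f u = len f (S f u)"
    using \<open>u \<in> L\<close> assms S_spec(2) unfolding foot_def by simp_all
  ultimately show ?thesis using A9 E_len by blast
qed

lemma foot_ray: assumes "foot L c f" "ray f c d" shows "foot L d f"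
proof -
  have "Col f c d" "f \<noteq> c" using assms(2) T_sym unfolding ray_def Col_iff by blast+
  then have "len d (S f x) = len d x" if "x \<in> L" for x
    using Col_equidistant[of f c d "S f x" x] assms(1) that S_spec(2) unfolding foot_def by blast
  then show ?thesis using assms unfolding foot_def by blast
qed

lemma foot_S: assumes "is_line L" "foot L c f" "n \<in> L" shows "foot L (S n c) (S n f)"
proof -
  have "len (S n c) (S (S n f) x) = len (S n c) x" if "x \<in> L" for x
  proof -
    have "len (S n c) (S (S n f) x) = len (S n c) (S n (S f (S n x)))" by (simp add: S_conj[of n f "S n x"])
    also have "\<dots> = len c (S f (S n x))" by (simp add: S_isometry)
    also have "\<dots> = len c (S n x)"
      using S_line[OF assms(1,3) that] assms(2) unfolding foot_def by blast
    also have "\<dots> = len (S n c) x" using S_isometry[of n c "S n x"] by simp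
    finally show ?thesis .
  qed
  then show ?thesis using assms S_line[OF assms(1,3)] unfolding foot_def by blast
qed

lemma len_S_foot: assumes "foot L c f" "x \<in> L" shows "len (S f c) x = len c x"
  using assms S_isometry[of f c "S f x"] unfolding foot_def by simp

text \<open>If \<open>S n b\<close> were the mirror image of \<open>c\<close>, then \<open>b\<close>, \<open>c\<close> and their feet would form a
  parallelogram, whose diagonals bisect each other.\<close>

lemma opp_equal_heights:
  assumes L: "is_line L" and o: "opp L b c" and fb: "foot L b f" and fc: "foot L c g"
    and n: "T f n g" "len n f = len n g" and h: "len f b = len g c"
  shows "c = S n b"
proof -
  obtain x where x: "x \<in> L" "T b x c" and nL: "b \<notin> L" "c \<notin> L" using o unfolding opp_def by blast
  have bc: "b \<noteq> c" using o opp_irrefl by blast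
  have fL: "f \<in> L" "g \<in> L" using fb fc unfolding foot_def by auto
  have once: "x = y" if "y \<in> L" "Col b c y" for y
  proof (rule ccontr)
    assume "x \<noteq> y"
    moreover have "x \<in> ln b c" "y \<in> ln b c" using that x unfolding ln_def Col_iff by blast+
    ultimately have "L = ln b c" using lines_meet_once[OF L is_line_ln[OF bc]] x that by blast
    then show False using nL by simp
  qed
  show ?thesis
  proof (cases "f = g")
    case True
    then have "n = f" using n by simp
    have "Col b c f" using foot_Col L fb fc True by blast
    then have "x = n" using once fL \<open>n = f\<close> by simp
    then show ?thesis using S_unique[of b n c] x h True \<open>n = f\<close> by simp
  next
    case False
    have g: "g = S n f" using S_unique n by simp
    have nL': "n \<in> L" using T_line(2)[OF L n(1)] fL by blast
    have fb': "foot L (S n b) g" using foot_S[OF L fb nL'] g by simp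
    have "Col c (S n b) g" using foot_Col[OF L fc fb'] .
    moreover have gb: "len g (S n b) = len g c" using S_isometry[of n f b] g h by simp
    ultimately have "c = S n b \<or> S n b = S g c"
      using Col_equidistant_T[of c "S n b" g] S_unique[of c g "S n b"] by metis
    then show ?thesis
    proof
      assume b': "S n b = S g c"
      have gb2: "len b g = len c f"
      proof -
        have "len b g = len (S n b) f" using S_isometry[of n b g] g by simp
        also have "\<dots> = len c f" using len_S_foot[OF fc fL(1)] b' by simp
        finally show ?thesis .
      qed
      \<comment> \<open>Exchanging \<open>b\<close> with \<open>c\<close> and \<open>f\<close> with
        \<open>g\<close> preserves all distances and takes \<open>x\<close> to \<open>x'\<close>.
        Hence \<open>x'\<close> is again on both \<open>bc\<close> and \<open>L\<close>, so
        \<open>x' = x\<close> is the common midpoint of the diagonals.\<close>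
      obtain x' where x': "T c x' b" "len b x = len c x'" "len x c = len x' b"
        using len_transport[OF x(2), of c b] len_commute by blast
      have 1: "len x f = len x' g"
        by (rule len_inner_five_segment[OF x(2) x'(1)]) (use x' h gb2 in \<open>simp_all add: len_commute\<close>)
      have 2: "len x g = len x' f"
        by (rule len_inner_five_segment[OF x(2) x'(1)]) (use x' h gb2 in \<open>simp_all add: len_commute\<close>)
      have "Col f g x" using line_eq_ln[OF L fL False] x unfolding ln_def by blast
      then have "Col g f x'"
        by (rule Col_congruent) (use 1 2 in \<open>simp_all add: len_commute\<close>)
      then have "x' \<in> L" using line_eq_ln[OF L fL(2,1)] False unfolding ln_def by blast
      moreover have "Col b c x'" using x' T_sym unfolding Col_iff by blast
      ultimately have xx: "x = x'" using once by blast
      then have "len x f = len x g" using 1 by simp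
      then have "T f x g" using Col_equidistant_T \<open>Col f g x\<close> False by blast
      then have "x = n" using midpoint_unique n \<open>len x f = len x g\<close> by blast
      then show ?thesis using S_unique[OF x(2)] x' xx by (simp add: len_commute)
    qed
  qed
qed

text \<open>The longer perpendicular is cut down to the length of the other one. If it is the one at
  \<open>g\<close>, the shortened point is still opposite to \<open>b\<close>, hence equal to
  \<open>S n b\<close>; otherwise the half-turn about \<open>n\<close> exchanges the two
  sides.\<close>

lemma opp_ray_feet:
  assumes L: "is_line L" and o: "opp L b c" and fb: "foot L b f" and fc: "foot L c g"
    and n: "T f n g" "len n f = len n g"
  shows "ray g c (S n b)"
proof -
  have *: "ray g c (S n b)" if o: "opp L b c" and fb: "foot L b f" and fc: "foot L c g"
    and n: "T f n g" "len n f = len n g" and le: "len f b \<le> len g c" for b c f g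
  proof -
    have nL: "b \<notin> L" "c \<notin> L" "f \<in> L" "g \<in> L" using o fb fc unfolding opp_def foot_def by blast+
    obtain d where d: "T g d c" "len g d = len f b" using len_le_point[OF le] by blast
    have dg: "d \<noteq> g" using d nL by (metis len_eq_0)
    have r: "ray g c d" using d dg nL unfolding ray_def by blast
    have "opp L d b" using opp_inner[OF L opp_sym[OF o] nL(4) d(1) dg] .
    moreover have "foot L d g" using foot_ray fc r by blast
    ultimately have "d = S n b"
      using opp_equal_heights[OF L opp_sym fb, of d g n] n d by simp
    then show ?thesis using r by simp
  qed
  show ?thesis
  proof (cases "len f b \<le> len g c")
    case True
    then show ?thesis using * assms by blast
  next
    case False
    then have le: "len g c \<le> len f b" using len_linear by blast
    have n': "T g n f" "len n g = len n f" using n T_sym by auto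
    have r: "ray f b (S n c)" using *[OF opp_sym[OF o] fc fb n' le] .
    have g: "g = S n f" using S_unique n by simp
    have "ray (S n f) (S n b) (S n (S n c))"
      using r T_S unfolding ray_def by (metis S_S)
    then show ?thesis using g ray_sym by simp
  qed
qed

text \<open>\<open>S n b\<close> is on the ray from \<open>g\<close> through \<open>d\<close>, and
  its half-turn image is \<open>b\<close>; so \<open>opp_S_ray\<close> applies with
  \<open>S n b\<close> as the starting point.\<close>

lemma opp_ray_foot:
  assumes L: "is_line L" and o: "opp L b c" and fc: "foot L c g" and d: "ray g c d"
  shows "opp L b d"
proof -
  obtain f where f: "foot L b f" using exists_foot L by blast
  obtain n where n: "T f n g" "len n f = len n g" using exists_midpoint by blast
  have "ray g (S n b) d" using opp_ray_feet[OF L o f fc n] d ray_sym ray_trans by blast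
  moreover have nL: "b \<notin> L" "f \<in> L" "g \<in> L" using o f fc unfolding opp_def foot_def by blast+
  moreover have nL': "n \<in> L" using T_line(2)[OF L n(1)] nL by blast
  moreover have "S n b \<notin> L" using S_line[OF L nL', of "S n b"] nL by auto
  ultimately have "opp L d (S n (S n b))" using opp_S_ray[OF L] by blast
  then show ?thesis using opp_sym by simp
qed

text \<open>The outer form of Pasch's axiom. The half-turn about the midpoint of the two feet carries \<open>a\<close>
  to the ray from the foot of \<open>c\<close> through \<open>c\<close>, which reduces it to the inner form \<open>A7\<close>.\<close>

lemma opp_ray:
  assumes L: "is_line L" and o: "opp L a c" and r: "r \<in> L" and b: "ray r a b"
  shows "opp L b c"
proof -
  obtain f where f: "foot L a f" using exists_foot L by blast
  obtain g where g: "foot L c g" using exists_foot L by blast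
  obtain n where n: "T f n g" "len n f = len n g" using exists_midpoint by blast
  have nL: "a \<notin> L" "f \<in> L" "g \<in> L" using o f g unfolding opp_def foot_def by blast+
  have nL': "n \<in> L" using T_line(2)[OF L n(1)] nL by blast
  have rg: "ray g c (S n a)" using opp_ray_feet[OF L o f g n] .
  have "opp L b (S n a)" using opp_S_ray[OF L nL' r nL(1) b] .
  moreover have "foot L (S n a) g" using foot_ray g rg by blast
  ultimately show ?thesis using opp_ray_foot[OF L] rg ray_sym by blast
qed

text \<open>Being on the same side is expressed by a common opposite point; its transitivity then
  amounts to plane separation, \<open>opp_same\<close>.\<close>

definition same :: "'p set \<Rightarrow> 'p \<Rightarrow> 'p \<Rightarrow> bool" where
  "same L a b \<longleftrightarrow> (\<exists>c. opp L a c \<and> opp L b c)"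

lemma same_sym: "same L a b \<Longrightarrow> same L b a" unfolding same_def by blast

text \<open>In the triangle \<open>a b d\<close>, inner Pasch gives a crossing point
  \<open>z\<close> of \<open>ya\<close> and \<open>xb\<close>. The point moves from \<open>a\<close>
  to \<open>z\<close> along a ray from \<open>y\<close>, then to \<open>b\<close> along a ray from
  \<open>x\<close>, and \<open>opp_ray\<close> applies to each move.\<close>

lemma opp_same:
  assumes L: "is_line L" and o: "opp L a c" and s: "same L a b" shows "opp L b c"
proof -
  obtain d x y where d: "x \<in> L" "T a x d" "y \<in> L" "T b y d" and n: "a \<notin> L" "b \<notin> L" "d \<notin> L"
    using s unfolding same_def opp_def by blast
  show ?thesis
  proof (cases "x = y")
    case True
    have "ray x a b" by (rule ray_opposite[of d]) (use True d n T_sym in blast)+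
    then show ?thesis using opp_ray[OF L o d(1)] by blast
  next
    case False
    show ?thesis
    proof (cases "a = b")
      case True then show ?thesis using o by simp
    next
      case ab: False
      have "\<not> Col a b d"
      proof
        assume "Col a b d"
        then have dl: "d \<in> ln a b" "is_line (ln a b)" using ab by (simp_all add: ln_def[of a b] is_line_ln[unfolded ln_def])
        then have "x \<in> ln a b" "y \<in> ln a b" using T_line(2)[OF dl(2)] d by auto
        then have "L = ln a b" using lines_meet_once[OF L dl(2)] d False by blast
        then show False using n by simp
      qed
      moreover have "B a x d" "B b y d" using d n B_iff by metis+
      ultimately obtain z where z: "B x z b" "B y z a" using A7[OF refl, of a x d b y] by blast
      have "ray y a z" "ray x z b" using z B_iff B_distinct unfolding ray_def by metis+
      then show ?thesis using opp_ray[OF L] o d by blast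
    qed
  qed
qed

lemma opp_not_same: "is_line L \<Longrightarrow> opp L a b \<Longrightarrow> \<not> same L a b"
  using opp_same opp_irrefl by blast

lemma opp_opp: "opp L a c \<Longrightarrow> opp L b c \<Longrightarrow> same L a b"
  unfolding same_def by blast

lemma same_trans: assumes "is_line L" "same L a b" "same L b c" shows "same L a c"
  using assms opp_same opp_opp same_sym unfolding same_def by meson

lemma opp_S: assumes "is_line L" "m \<in> L" "a \<notin> L" shows "opp L a (S m a)"
  unfolding opp_def using assms S_line[of L m "S m a"] S_spec(1) by auto

lemma ray_same: assumes "is_line L" "r \<in> L" "a \<notin> L" "ray r a b" shows "same L a b"
  using opp_S[OF assms(1-3)] opp_ray[OF assms(1) _ assms(2,4)] unfolding same_def by blast

text \<open>The half-turn about the midpoint of the two feet carries \<open>b\<close> to the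
  perpendicular through \<open>a\<close>. There it only remains to see whether \<open>f\<close> is
  between the two points.\<close>

lemma same_or_opp: assumes L: "is_line L" and n: "a \<notin> L" "b \<notin> L" shows "same L a b \<or> opp L a b"
proof -
  obtain f where f: "foot L a f" using exists_foot L by blast
  obtain g where g: "foot L b g" using exists_foot L by blast
  obtain m where m: "T g m f" "len m g = len m f" using exists_midpoint by blast
  have fg: "f \<in> L" "g \<in> L" using f g unfolding foot_def by auto
  have mL: "m \<in> L" using T_line(2)[OF L m(1)] fg by blast
  have "S m g = f" using S_unique m by metis
  then have "foot L (S m b) f" using foot_S[OF L g mL] by simp
  then have c: "Col a (S m b) f" using foot_Col L f by blast
  have b': "S m b \<notin> L" using S_line[OF L mL, of "S m b"] n by auto
  have ne: "a \<noteq> f" "S m b \<noteq> f" "S f a \<noteq> f" using n fg b' by auto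
  show ?thesis
  proof (cases "T a f (S m b)")
    case True
    have "ray f (S m b) (S f a)" by (rule ray_opposite[OF True S_spec(1) ne])
    then have "opp L (S f a) (S m (S m b))" using opp_S_ray[OF L mL fg(1) b'] by blast
    then have "opp L b (S f a)" using opp_sym by simp
    then show ?thesis using opp_S[OF L fg(1) n(1)] unfolding same_def by blast
  next
    case False
    then have "ray f (S m b) a" using c ne T_sym unfolding ray_def Col_iff by blast
    then have "opp L a (S m (S m b))" using opp_S_ray[OF L mL fg(1) b'] by blast
    then show ?thesis by simp
  qed
qed

lemma same_notin: "same L a b \<Longrightarrow> a \<notin> L" "same L a b \<Longrightarrow> b \<notin> L"
  unfolding same_def opp_def by blast+

lemma same_convex: assumes "is_line L" "same L a b" "T a x b" shows "same L a x"
proof -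
  have "\<not> opp L a b" using assms opp_not_same by blast
  then have n: "\<not> (\<exists>t\<in>L. T a t b)" using same_notin assms(2) unfolding opp_def by blast
  then have "\<not> opp L a x" "x \<notin> L" using assms(3) T_exchange(2) unfolding opp_def by blast+
  then show ?thesis using same_or_opp assms same_notin by blast
qed

subsection \<open>Perturbation of lengths, sides and lines\<close>

text \<open>The type \<open>length\<close> also has elements that are not lengths of segments;
  \<open>pos\<close> excludes them together with the zero length, so any two of its members are
  comparable.\<close>

definition pos :: "'p length \<Rightarrow> bool" where
  "pos \<delta> \<longleftrightarrow> (\<exists>a b. a \<noteq> b \<and> \<delta> = len a b)"

text \<open>The analogue of \<open>eventually\<close> at zero from the right: finitely many
  conditions combine without explicit minima.\<close>

definition small :: "('p length \<Rightarrow> bool) \<Rightarrow> bool" where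
  "small P \<longleftrightarrow> (\<exists>\<delta>\<^sub>0. pos \<delta>\<^sub>0 \<and> (\<forall>\<delta>. pos \<delta> \<longrightarrow> \<delta> \<le> \<delta>\<^sub>0 \<longrightarrow> P \<delta>))"

lemma pos_len [simp]: "pos (len a b) \<longleftrightarrow> a \<noteq> b"
  unfolding pos_def by (metis len_eq_0)

lemma smallI: "pos \<delta>\<^sub>0 \<Longrightarrow> (\<And>\<delta>. pos \<delta> \<Longrightarrow> \<delta> \<le> \<delta>\<^sub>0 \<Longrightarrow> P \<delta>) \<Longrightarrow> small P"
  unfolding small_def by blast

lemma small_ex: "small P \<Longrightarrow> \<exists>\<delta>. pos \<delta> \<and> P \<delta>"
  unfolding small_def by auto

lemma small_conj: assumes "small P" "small Q" shows "small (\<lambda>\<delta>. P \<delta> \<and> Q \<delta>)"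
proof -
  obtain d e where d: "pos d" "\<And>\<delta>. pos \<delta> \<Longrightarrow> \<delta> \<le> d \<Longrightarrow> P \<delta>"
    and e: "pos e" "\<And>\<delta>. pos \<delta> \<Longrightarrow> \<delta> \<le> e \<Longrightarrow> Q \<delta>"
    using assms unfolding small_def by blast
  have "d \<le> e \<or> e \<le> d" using d(1) e(1) len_linear unfolding pos_def by blast
  then show ?thesis
  proof
    assume "d \<le> e"
    then show ?thesis by (intro smallI[OF d(1)]) (use d e in \<open>auto intro: order.trans\<close>)
  next
    assume "e \<le> d"
    then show ?thesis by (intro smallI[OF e(1)]) (use d e in \<open>auto intro: order.trans\<close>)
  qed
qed

lemma small_mono: "small P \<Longrightarrow> (\<And>\<delta>. pos \<delta> \<Longrightarrow> P \<delta> \<Longrightarrow> Q \<delta>) \<Longrightarrow> small Q"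
  unfolding small_def by blast

abbreviation near :: "'p length \<Rightarrow> 'p \<Rightarrow> 'p \<Rightarrow> bool" where
  "near \<delta> x x' \<equiv> len x x' \<le> \<delta>"

lemma near_refl [simp]: "pos \<delta> \<Longrightarrow> near \<delta> x x" unfolding pos_def by auto

section \<open>Strict relations persist under small perturbations\<close>

lemma len_dense: assumes "len a b < len c d" shows "\<exists>e. T c e d \<and> e \<noteq> d \<and> len a b < len c e \<and> len c e < len c d"
proof -
  obtain q where q: "T c q d" "len c q = len a b" using len_le_point assms order.strict_implies_order by blast
  have ne: "q \<noteq> d" using q assms by auto
  obtain m where m: "T q m d" "len m q = len m d" using exists_midpoint by blast
  have md: "m \<noteq> q" "m \<noteq> d" using m ne by (metis len_eq_0)+
  have "T c q m" "T c m d" using T_inner T_inner2 q m by blast+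
  then show ?thesis using len_strict[of c q m] len_strict[of c m d] md q by auto
qed

text \<open>The admissible motion is \<open>len d q\<close>, the excess of \<open>cd\<close> over
  \<open>ab\<close>.\<close>

lemma triangle_margin:
  assumes "len a b < len c d"
  shows "small (\<lambda>\<delta>. \<forall>x x' y. near \<delta> x x' \<longrightarrow> len x y \<le> len a b \<longrightarrow> len x' y \<le> len c d)"
proof -
  obtain q where q: "T c q d" "len c q = len a b" using len_le_point assms order.strict_implies_order by blast
  have ne: "d \<noteq> q" using q assms by auto
  show ?thesis
  proof (rule smallI[of "len d q"], use ne in simp, intro allI impI)
    fix \<delta> x x' y assume "\<delta> \<le> len d q" "near \<delta> x x'" "len x y \<le> len a b"
    then have "len x' x \<le> len d q" "len x y \<le> len q c" using q by (simp_all add: len_commute)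
    then have "len x' y \<le> len d c" using triangle_inequality q(1) T_sym by blast
    then show "len x' y \<le> len c d" by (simp add: len_commute)
  qed
qed

text \<open>Four endpoints move, so the gap is divided by \<open>e1\<close> to \<open>e4\<close>
  into steps that absorb one motion each: two enlarge the left side, two account for the right
  side.\<close>

lemma len_less_open:
  assumes "len x y < len z w"
  shows "small (\<lambda>\<delta>. \<forall>x' y' z' w'. near \<delta> x x' \<longrightarrow> near \<delta> y y' \<longrightarrow> near \<delta> z z' \<longrightarrow> near \<delta> w w'
    \<longrightarrow> len x' y' < len z' w')"
proof -
  obtain e1 where 1: "len x y < len z e1" "len z e1 < len z w" using len_dense[OF assms] by blast
  obtain e2 where 2: "len z e1 < len z e2" "len z e2 < len z w" using len_dense[OF 1(2)] by blast
  obtain e3 where 3: "len z e2 < len z e3" "len z e3 < len z w" using len_dense[OF 2(2)] by blast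
  obtain e4 where 4: "len z e3 < len z e4" "len z e4 < len z w" using len_dense[OF 3(2)] by blast
  show ?thesis
  proof (rule small_mono[OF small_conj[OF small_conj[OF triangle_margin[OF 1(1)] triangle_margin[OF 2(1)]]
      small_conj[OF triangle_margin[OF 3(1)] triangle_margin[OF 4(1)]]]], intro allI impI)
    fix \<delta> x' y' z' w'
    assume m: "((\<forall>xa x' ya. near \<delta> xa x' \<longrightarrow> len xa ya \<le> len x y \<longrightarrow> len x' ya \<le> len z e1) \<and>
        (\<forall>x x' y. near \<delta> x x' \<longrightarrow> len x y \<le> len z e1 \<longrightarrow> len x' y \<le> len z e2)) \<and>
       (\<forall>x x' y. near \<delta> x x' \<longrightarrow> len x y \<le> len z e2 \<longrightarrow> len x' y \<le> len z e3) \<and>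
       (\<forall>x x' y. near \<delta> x x' \<longrightarrow> len x y \<le> len z e3 \<longrightarrow> len x' y \<le> len z e4)"
    assume n: "near \<delta> x x'" "near \<delta> y y'" "near \<delta> z z'" "near \<delta> w w'"
    have "len x' y \<le> len z e1" using m n(1) by blast
    then have "len y x' \<le> len z e1" by (simp add: len_commute)
    then have "len y' x' \<le> len z e2" using m n(2) by blast
    then have a: "len x' y' \<le> len z e2" by (simp add: len_commute)
    have "len z e2 < len z' w'"
    proof (rule ccontr)
      assume "\<not> ?thesis"
      then have "len z' w' \<le> len z e2" by (simp add: len_not_less)
      moreover have "near \<delta> z' z" "near \<delta> w' w" using n by (simp_all add: len_commute)
      ultimately have "len z w' \<le> len z e3" using m by blast
      then have "len w' z \<le> len z e3" by (simp add: len_commute)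
      then have "len w z \<le> len z e4" using m \<open>near \<delta> w' w\<close> by blast
      then show False using 4(2) by (simp add: len_commute)
    qed
    then show "len x' y' < len z' w'" using a by order
  qed
qed

text \<open>Among collinear points, the middle one is recognized by strict inequalities: its
  distances from the others are less than their mutual distance.\<close>

lemma T_open:
  assumes "T p q r" "p \<noteq> q" "q \<noteq> r"
  shows "small (\<lambda>\<delta>. \<forall>p' q' r'. near \<delta> p p' \<longrightarrow> near \<delta> q q' \<longrightarrow> near \<delta> r r' \<longrightarrow> Col p' q' r' \<longrightarrow> T p' q' r')"
proof -
  have 1: "len p q < len p r" "len q r < len p r" using len_strict len_strict' assms by blast+
  show ?thesis
  proof (rule small_mono[OF small_conj[OF len_less_open[OF 1(1)] len_less_open[OF 1(2)]]], intro allI impI)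
    fix \<delta> p' q' r'
    assume m: "(\<forall>x' y' z' w'. near \<delta> p x' \<longrightarrow> near \<delta> q y' \<longrightarrow> near \<delta> p z' \<longrightarrow> near \<delta> r w' \<longrightarrow> len x' y' < len z' w') \<and>
     (\<forall>x' y' z' w'. near \<delta> q x' \<longrightarrow> near \<delta> r y' \<longrightarrow> near \<delta> p z' \<longrightarrow> near \<delta> r w' \<longrightarrow> len x' y' < len z' w')"
    assume n: "near \<delta> p p'" "near \<delta> q q'" "near \<delta> r r'" and c: "Col p' q' r'"
    have "len p' q' < len p' r'" "len q' r' < len p' r'" using m n by blast+
    then have "\<not> T q' p' r'" "\<not> T p' r' q'"
      using T_len_le[of q' p' r'] T_len_le[of p' r' q'] by (auto simp: len_commute)
    then show "T p' q' r'" using c T_sym unfolding Col_iff by blast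
  qed
qed

lemma neq_open:
  assumes "p \<noteq> q"
  shows "small (\<lambda>\<delta>. \<forall>p' q'. near \<delta> p p' \<longrightarrow> near \<delta> q q' \<longrightarrow> p' \<noteq> q')"
proof -
  have "len p p < len p q" using len_strict[of p p q] assms by simp
  from len_less_open[OF this] show ?thesis
    by (rule small_mono) (metis order.irrefl near_refl len_not_less len_ge_0)
qed

text \<open>If \<open>a\<close> is between \<open>u\<close> and \<open>b\<close>, then
  \<open>ab < ub\<close>. This persists and prevents \<open>u'\<close> from coming between
  \<open>a'\<close> and \<open>b'\<close>; collinear points off \<open>u'\<close> that it does not
  separate are on one ray.\<close>

lemma ray_open:
  assumes "ray u a b"
  shows "small (\<lambda>\<delta>. \<forall>u' a' b'. near \<delta> u u' \<longrightarrow> near \<delta> a a' \<longrightarrow> near \<delta> b b' \<longrightarrow> Col u' a' b' \<longrightarrow> ray u' a' b')"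
proof -
  have *: "small (\<lambda>\<delta>. \<forall>u' a' b'. near \<delta> u u' \<longrightarrow> near \<delta> a a' \<longrightarrow> near \<delta> b b' \<longrightarrow> \<not> T a' u' b')"
    if t: "T u a b" "a \<noteq> u" for a b
  proof -
    have "len a b < len u b" using len_strict' t by blast
    from len_less_open[OF this] show ?thesis
    proof (rule small_mono, intro allI impI)
      fix \<delta> u' a' b'
      assume m: "\<forall>x' y' z' w'. near \<delta> a x' \<longrightarrow> near \<delta> b y' \<longrightarrow> near \<delta> u z' \<longrightarrow> near \<delta> b w' \<longrightarrow> len x' y' < len z' w'"
        and n: "near \<delta> u u'" "near \<delta> a a'" "near \<delta> b b'"
      have "len a' b' < len u' b'" using m n by blast
      then show "\<not> T a' u' b'" using T_len_le(2)[of a' u' b'] by auto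
    qed
  qed
  have ne: "u \<noteq> a" "u \<noteq> b" using assms unfolding ray_def by auto
  have "small (\<lambda>\<delta>. \<forall>u' a' b'. near \<delta> u u' \<longrightarrow> near \<delta> a a' \<longrightarrow> near \<delta> b b' \<longrightarrow> \<not> T a' u' b')"
  proof (cases "T u a b")
    case True then show ?thesis using * ne by blast
  next
    case False
    then have "small (\<lambda>\<delta>. \<forall>u' b' a'. near \<delta> u u' \<longrightarrow> near \<delta> b b' \<longrightarrow> near \<delta> a a' \<longrightarrow> \<not> T b' u' a')"
      using *[of b a] ne assms unfolding ray_def by blast
    then show ?thesis by (rule small_mono) (use T_sym in blast)
  qed
  from small_conj[OF this small_conj[OF neq_open[OF ne(1)] neq_open[OF ne(2)]]] show ?thesis
    by (rule small_mono) (unfold ray_def Col_iff, use T_sym in blast)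
qed

text \<open>A disc about \<open>b\<close> with radius less than the distance to the foot does not
  meet the line, and neither do the segments from \<open>b\<close> to its points.\<close>

lemma same_open:
  assumes L: "is_line L" and s: "same L a b"
  shows "small (\<lambda>\<delta>. \<forall>b'. near \<delta> b b' \<longrightarrow> same L a b')"
proof -
  have b: "b \<notin> L" using s same_notin by blast
  obtain f where f: "foot L b f" using exists_foot L by blast
  have bf: "b \<noteq> f" using foot_notin f b by blast
  obtain e where e: "len b b < len b e" "len b e < len b f"
    using len_dense[of b b b f] len_strict[of b b f] bf by auto
  show ?thesis
  proof (rule smallI[of "len b e"])
    show "pos (len b e)" using e by auto
    fix \<delta> assume d: "\<delta> \<le> len b e"
    show "\<forall>b'. near \<delta> b b' \<longrightarrow> same L a b'"
    proof (intro allI impI)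
      fix b' assume "near \<delta> b b'"
      then have l: "len b b' < len b f" using d e by order
      have *: "\<not> T b t b'" if "t \<in> L" for t
      proof
        assume "T b t b'"
        then have "len b t \<le> len b b'" using T_len_le by blast
        moreover have "len b f \<le> len b t" using foot_le f that by blast
        ultimately show False using l by order
      qed
      have "b' \<notin> L" using *[of b'] by auto
      moreover have "\<not> opp L b b'" using * unfolding opp_def by blast
      ultimately have "same L b b'" using same_or_opp L b by blast
      then show "same L a b'" using same_trans L s by blast
    qed
  qed
qed

lemma opp_open:
  assumes L: "is_line L" and s: "opp L a b"
  shows "small (\<lambda>\<delta>. \<forall>b'. near \<delta> b b' \<longrightarrow> opp L a b')"
proof -
  have "same L b b" using s opp_sym opp_opp by blast
  from same_open[OF L this] show ?thesis
    by (rule small_mono) (use opp_same[OF L] opp_sym s in blast)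
qed

text \<open>The line \<open>ab\<close>, directed from \<open>a\<close> to \<open>b\<close>, enters
  the triangle \<open>o' s\<^sub>1 s\<^sub>2\<close> through the angle vertically opposite to
  the one at \<open>o'\<close>, so it has to leave it through the side \<open>s\<^sub>1 s\<^sub>2\<close>.\<close>

lemma wedge_aux:
  assumes nc: "\<not> Col o' s\<^sub>1 s\<^sub>2" and ab: "a \<noteq> b"
    and b1: "same (ln o' s\<^sub>1) s\<^sub>2 b" and b2: "same (ln o' s\<^sub>2) s\<^sub>1 b" and b3: "same (ln s\<^sub>1 s\<^sub>2) o' b"
    and c1: "c\<^sub>1 \<in> ln o' s\<^sub>1" "T a c\<^sub>1 b" and c2: "c\<^sub>2 \<in> ln o' s\<^sub>2" "T a c\<^sub>2 b" and t: "T a c\<^sub>1 c\<^sub>2"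
  shows "\<exists>t. Col a b t \<and> T s\<^sub>1 t s\<^sub>2"
proof -
  have ne: "o' \<noteq> s\<^sub>1" "o' \<noteq> s\<^sub>2" "s\<^sub>1 \<noteq> s\<^sub>2" using nc by auto
  let ?l1 = "ln o' s\<^sub>1" and ?l2 = "ln o' s\<^sub>2" and ?l3 = "ln s\<^sub>1 s\<^sub>2" and ?L = "ln a b"
  have L: "is_line ?l1" "is_line ?l2" "is_line ?l3" "is_line ?L" using ne ab by auto
  have s2: "s\<^sub>2 \<notin> ?l1" "s\<^sub>1 \<notin> ?l2" "o' \<notin> ?l3" using nc Col_swap unfolding ln_def by blast+
  have bn: "b \<notin> ?l1" "b \<notin> ?l2" "b \<notin> ?l3" using b1 b2 b3 same_notin by blast+
  have o12: "x = o'" if "x \<in> ?l1" "x \<in> ?l2" for x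
  proof (rule ccontr)
    assume "x \<noteq> o'"
    then have "?l1 = ?l2" using lines_meet_once[OF L(1,2)] that ln_mem by blast
    then show False using s2 ln_mem by blast
  qed
  have once1: "x = y" if "x \<in> ?l1" "x \<in> ?L" "y \<in> ?l1" "y \<in> ?L" for x y
    using lines_meet_once[OF L(1,4)] that bn ln_mem by metis
  have once2: "x = y" if "x \<in> ?l2" "x \<in> ?L" "y \<in> ?l2" "y \<in> ?L" for x y
    using lines_meet_once[OF L(2,4)] that bn ln_mem by metis
  have cL: "c\<^sub>1 \<in> ?L" "c\<^sub>2 \<in> ?L" using c1 c2 T_line(2)[OF L(4)] by (blast intro: ln_mem)+
  have tc: "T c\<^sub>1 c\<^sub>2 b" using T_exchange(1) t c2 by blast
  have done': ?thesis if "opp ?L s\<^sub>1 s\<^sub>2" using that unfolding opp_def ln_def by blast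
  show ?thesis
  proof (cases "c\<^sub>1 = c\<^sub>2")
    case True
    then have o: "o' \<in> ?L" using o12 c1 c2 cL by blast
    have sn: "s\<^sub>1 \<notin> ?L" "s\<^sub>2 \<notin> ?L" using once1[of s\<^sub>1 o'] once2[of s\<^sub>2 o'] o ne ln_mem by blast+
    show ?thesis
    proof (rule ccontr)
      assume "\<not> ?thesis"
      then have s: "same ?L s\<^sub>1 s\<^sub>2" using done' same_or_opp[OF L(4) sn] by blast
      \<comment> \<open>If \<open>ab\<close> did not separate the two corners, it would meet the
        segment from the second corner to \<open>?s\<close> at a point \<open>k\<close>. This is on
        the ray from \<open>o'\<close> through \<open>b\<close>, hence on the first corner's side of
        \<open>?l2\<close>; but the segment lies on the side of \<open>?s\<close>, which is
        opposite.\<close>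
      let ?s = "S o' s\<^sub>1"
      have "opp ?L s\<^sub>1 ?s" using opp_S[OF L(4) o sn(1)] .
      then have "opp ?L s\<^sub>2 ?s" using opp_same[OF L(4)] s by blast
      then obtain k where k: "k \<in> ?L" "T s\<^sub>2 k ?s" and sn': "?s \<notin> ?L" unfolding opp_def by blast
      have s1: "?s \<in> ?l1" using S_line[OF L(1)] ln_mem by blast
      have "k \<noteq> ?s" "k \<noteq> s\<^sub>2" using k sn' sn by auto
      have "T ?s k s\<^sub>2" using k T_sym by blast
      then have "ray ?s s\<^sub>2 k" using \<open>k \<noteq> ?s\<close> s1 s2 unfolding ray_def by blast
      then have "same ?l1 s\<^sub>2 k" using ray_same[OF L(1) s1 s2(1)] by blast
      then have bk: "same ?l1 b k" using same_trans L(1) same_sym b1 by blast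
      then have "\<not> T b o' k" using opp_not_same L(1) ln_mem same_notin unfolding opp_def by blast
      moreover have "k \<noteq> o'" "b \<noteq> o'" using bk same_notin ln_mem by blast+
      moreover have "Col o' b k"
      proof -
        have "?L = ln o' b" using line_eq_ln[OF L(4) o] \<open>b \<noteq> o'\<close> ln_mem by metis
        then show ?thesis using k unfolding ln_def by blast
      qed
      ultimately have "ray o' b k" using T_sym unfolding ray_def Col_iff by blast
      then have "same ?l2 b k" using ray_same[OF L(2) _ bn(2)] ln_mem by blast
      then have 1: "same ?l2 s\<^sub>1 k" using same_trans[OF L(2)] b2 by blast
      have 2: "opp ?l2 s\<^sub>1 ?s" using opp_S[OF L(2) _ s2(2)] ln_mem by blast
      then have "?s \<notin> ?l2" unfolding opp_def by blast
      moreover have "ray s\<^sub>2 ?s k" using k \<open>k \<noteq> s\<^sub>2\<close> \<open>?s \<notin> ?l2\<close> ln_mem unfolding ray_def by blast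
      ultimately have "same ?l2 ?s k" using ray_same[OF L(2)] ln_mem by blast
      then have "same ?l2 s\<^sub>1 ?s" using same_trans[OF L(2) 1] same_sym by blast
      then show False using 2 opp_not_same L(2) by blast
    qed
  next
    case False
    have o: "o' \<notin> ?L" using once1[of o' c\<^sub>1] once2[of o' c\<^sub>2] c1 c2 cL False ln_mem by blast
    then have oc: "o' \<noteq> c\<^sub>1" "o' \<noteq> c\<^sub>2" using cL by auto
    have c1n: "c\<^sub>1 \<notin> ?l2" and c2n: "c\<^sub>2 \<notin> ?l1" using o12 oc c1 c2 by blast+
    have "opp ?l2 b c\<^sub>1" using c1n bn c2 tc T_sym unfolding opp_def by blast
    then have "opp ?l2 s\<^sub>1 c\<^sub>1" using opp_same[OF L(2)] b2 same_sym by blast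
    then obtain x where x: "x \<in> ?l2" "T s\<^sub>1 x c\<^sub>1" unfolding opp_def by blast
    then have "x \<in> ?l1" using T_line(2)[OF L(1) x(2)] c1 ln_mem by blast
    then have t1: "T s\<^sub>1 o' c\<^sub>1" using o12 x by blast
    have "ray c\<^sub>1 b c\<^sub>2" using tc False c1 bn unfolding ray_def by blast
    then have "same ?l1 b c\<^sub>2" using ray_same[OF L(1)] c1 bn by blast
    then have "same ?l1 s\<^sub>2 c\<^sub>2" using same_trans[OF L(1)] b1 by blast
    then have "\<not> T s\<^sub>2 o' c\<^sub>2" using opp_not_same L(1) same_notin ln_mem unfolding opp_def by blast
    then have "T o' c\<^sub>2 s\<^sub>2 \<or> T o' s\<^sub>2 c\<^sub>2" using c2(1) T_sym unfolding ln_def Col_iff by blast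
    \<comment> \<open>The line may leave at the corner itself. If it leaves before the corner, it
      separates \<open>o'\<close> from the second corner, and the first corner is on the side of
      \<open>o'\<close>. Leaving beyond the corner is impossible: \<open>c\<^sub>1\<close> and
      \<open>b\<close> are on the side of \<open>?l3\<close> that contains \<open>o'\<close>, hence
      so is \<open>c\<^sub>2\<close>.\<close>
    then consider "c\<^sub>2 = s\<^sub>2" | "T o' c\<^sub>2 s\<^sub>2" "c\<^sub>2 \<noteq> s\<^sub>2" | "T o' s\<^sub>2 c\<^sub>2" "c\<^sub>2 \<noteq> s\<^sub>2" by blast
    then show ?thesis
    proof cases
      case 1
      then show ?thesis using cL T_triv unfolding ln_def by blast
    next
      case 2
      have "s\<^sub>2 \<notin> ?L" using once2[of s\<^sub>2 c\<^sub>2] c2 cL ln_mem 2 by blast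
      then have "opp ?L o' s\<^sub>2" using 2 o cL unfolding opp_def by blast
      moreover have "s\<^sub>1 \<noteq> c\<^sub>1" using t1 ne by auto
      then have "ray c\<^sub>1 o' s\<^sub>1" using t1 oc T_sym unfolding ray_def by blast
      ultimately show ?thesis using done' opp_ray[OF L(4)] cL by blast
    next
      case 3
      have "c\<^sub>2 \<notin> ?l3" using T_line(3)[OF L(3) 3(1)] s2(3) 3 ln_mem by blast
      then have op: "opp ?l3 o' c\<^sub>2" using 3 s2 ln_mem unfolding opp_def by blast
      have "s\<^sub>1 \<noteq> c\<^sub>1" using t1 ne by auto
      then have "ray s\<^sub>1 o' c\<^sub>1" using t1 ne unfolding ray_def by blast
      then have "same ?l3 o' c\<^sub>1" using ray_same[OF L(3) _ s2(3)] ln_mem by blast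
      then have "same ?l3 c\<^sub>1 b" using same_trans[OF L(3)] b3 same_sym by blast
      then have "same ?l3 c\<^sub>1 c\<^sub>2" using same_convex[OF L(3)] tc by blast
      then have "same ?l3 o' c\<^sub>2" using same_trans[OF L(3)] \<open>same ?l3 o' c\<^sub>1\<close> by blast
      then show ?thesis using op opp_not_same L(3) by blast
    qed
  qed
qed

text \<open>\<open>wedge_aux\<close> wants the side line through \<open>s\<^sub>1\<close> to be
  crossed first; otherwise the two sides exchange their roles.\<close>

lemma wedge:
  assumes nc: "\<not> Col o' s\<^sub>1 s\<^sub>2"
    and b: "same (ln o' s\<^sub>1) s\<^sub>2 b" "same (ln o' s\<^sub>2) s\<^sub>1 b" "same (ln s\<^sub>1 s\<^sub>2) o' b"
    and a: "opp (ln o' s\<^sub>1) s\<^sub>2 a" "opp (ln o' s\<^sub>2) s\<^sub>1 a"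
  shows "\<exists>t. Col a b t \<and> T s\<^sub>1 t s\<^sub>2"
proof -
  have ne: "o' \<noteq> s\<^sub>1" "o' \<noteq> s\<^sub>2" using nc by auto
  then have L: "is_line (ln o' s\<^sub>1)" "is_line (ln o' s\<^sub>2)" by auto
  have "opp (ln o' s\<^sub>1) a b" "opp (ln o' s\<^sub>2) a b"
    using opp_same[OF L(1) a(1) b(1)] opp_same[OF L(2) a(2) b(2)] opp_sym by blast+
  moreover from this have "a \<noteq> b" using opp_irrefl by blast
  ultimately obtain c\<^sub>1 c\<^sub>2 where c: "c\<^sub>1 \<in> ln o' s\<^sub>1" "T a c\<^sub>1 b" "c\<^sub>2 \<in> ln o' s\<^sub>2" "T a c\<^sub>2 b"
    unfolding opp_def by blast
  have nc': "\<not> Col o' s\<^sub>2 s\<^sub>1" using nc Col_swap by blast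
  have b3: "same (ln s\<^sub>2 s\<^sub>1) o' b" using b(3) ln_commute by metis
  have "T a c\<^sub>1 c\<^sub>2 \<or> T a c\<^sub>2 c\<^sub>1" using T_connect3 c by blast
  then show ?thesis
    using wedge_aux[OF nc \<open>a \<noteq> b\<close> b c] wedge_aux[OF nc' \<open>a \<noteq> b\<close> b(2,1) b3 c(3,4,1,2)] T_sym by blast
qed

lemma exists_near_on_segment:
  assumes "pos \<epsilon>" "p \<noteq> w" shows "\<exists>s. T p s w \<and> s \<noteq> p \<and> len p s \<le> \<epsilon>"
proof -
  obtain c d where e: "\<epsilon> = len c d" "c \<noteq> d" using assms unfolding pos_def by blast
  show ?thesis
  proof (cases "len p w \<le> \<epsilon>")
    case True then show ?thesis using assms T_triv by blast
  next
    case False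
    then have "len c d \<le> len p w" using e len_linear by blast
    then obtain s where s: "T p s w" "len p s = len c d" using len_le_point by blast
    then have "s \<noteq> p" using e by (metis len_eq_0)
    then show ?thesis using s e by auto
  qed
qed

text \<open>The angle at the midpoint \<open>m\<close> of \<open>ab\<close> over a short segment \<open>s\<^sub>1 s\<^sub>2\<close> through \<open>p\<close> contains
  \<open>b\<close>, and the vertically opposite angle contains \<open>a\<close>.\<close>

lemma line_point_near_beyond:
  assumes t: "T a b p" "a \<noteq> b" "b \<noteq> p" and e: "pos \<epsilon>"
  shows "small (\<lambda>\<delta>. \<forall>a' b'. near \<delta> a a' \<longrightarrow> near \<delta> b b' \<longrightarrow> (\<exists>t. Col a' b' t \<and> near \<epsilon> p t))"
proof -
  obtain w where w: "\<not> Col a b w" using exists_not_Col t by blast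
  let ?L = "ln a b"
  have L: "is_line ?L" using t by blast
  have wL: "w \<notin> ?L" using w unfolding ln_def by blast
  have pL: "p \<in> ?L" using t unfolding ln_def Col_iff by blast
  then have "p \<noteq> w" using wL by auto
  then obtain s\<^sub>1 where s: "T p s\<^sub>1 w" "s\<^sub>1 \<noteq> p" "len p s\<^sub>1 \<le> \<epsilon>" using exists_near_on_segment e by blast
  have s1L: "s\<^sub>1 \<notin> ?L" using T_line(1)[OF L s(1) pL] wL s by blast
  define s\<^sub>2 where "s\<^sub>2 = S p s\<^sub>1"
  have s2: "T s\<^sub>1 p s\<^sub>2" "len p s\<^sub>2 = len p s\<^sub>1" "s\<^sub>2 \<noteq> p" using S_spec s unfolding s\<^sub>2_def by auto
  have s2L: "s\<^sub>2 \<notin> ?L" using S_line[OF L pL, of s\<^sub>2] s1L unfolding s\<^sub>2_def by auto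
  obtain m where m: "T a m b" "len m a = len m b" using exists_midpoint by blast
  have mne: "m \<noteq> a" "m \<noteq> b" using m t by (metis len_eq_0)+
  have mL: "m \<in> ?L" using T_line(2)[OF L m(1)] ln_mem by blast
  have tm: "T m b p" "T a m p" using T_exchange t(1) m(1) by blast+
  have mp: "m \<noteq> p" using tm(1) mne t by auto
  have mn: "m \<noteq> s\<^sub>1" "m \<noteq> s\<^sub>2" "s\<^sub>1 \<noteq> s\<^sub>2" using mL s1L s2L s2 s by auto
  have L3: "is_line (ln s\<^sub>1 s\<^sub>2)" and p3: "p \<in> ln s\<^sub>1 s\<^sub>2" using mn s2 T_line(2)[of "ln s\<^sub>1 s\<^sub>2" s\<^sub>1 p s\<^sub>2] by auto
  have m3: "m \<notin> ln s\<^sub>1 s\<^sub>2" and b3: "b \<notin> ln s\<^sub>1 s\<^sub>2"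
    using lines_meet_once[OF L L3 _ pL _ p3] mL mp t s1L ln_mem by blast+
  have b3': "same (ln s\<^sub>1 s\<^sub>2) m b"
  proof (rule ray_same[OF L3 p3 m3])
    have "T p b m" using tm T_sym by blast
    then show "ray p m b" using mp t unfolding ray_def by blast
  qed
  have *: "same (ln m s) s' b \<and> opp (ln m s) s' a"
    if st: "T s p s'" "s \<notin> ?L" "s' \<notin> ?L" for s s'
  proof -
    have "m \<noteq> s" using mL st by auto
    then have L1: "is_line (ln m s)" by blast
    have bn: "b \<notin> ln m s" "a \<notin> ln m s" "p \<notin> ln m s"
      using lines_meet_once[OF L L1 _ mL _ ln_mem(1)] mne mp st pL ln_mem by blast+
    have "s \<noteq> p" "s' \<noteq> s" using bn st pL by auto
    then have "ray s p s'" using st unfolding ray_def by blast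
    then have 1: "same (ln m s) p s'" using ray_same[OF L1 _ bn(3)] ln_mem by blast
    have "ray m b p" using tm mne mp unfolding ray_def by blast
    then have "same (ln m s) b p" using ray_same[OF L1 _ bn(1)] ln_mem by blast
    then have sb: "same (ln m s) b s'" using 1 same_trans[OF L1] by blast
    have "opp (ln m s) b a" using bn m T_sym ln_mem unfolding opp_def by blast
    then show ?thesis using opp_same[OF L1] sb same_sym opp_sym by blast
  qed
  have c1: "same (ln m s\<^sub>1) s\<^sub>2 b" "opp (ln m s\<^sub>1) s\<^sub>2 a" using *[OF s2(1) s1L s2L] by auto
  have c2: "same (ln m s\<^sub>2) s\<^sub>1 b" "opp (ln m s\<^sub>2) s\<^sub>1 a" using *[OF _ s2L s1L] s2(1) T_sym by blast+
  have nc: "\<not> Col m s\<^sub>1 s\<^sub>2" using m3 Col_swap unfolding ln_def by blast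
  have L1: "is_line (ln m s\<^sub>1)" and L2: "is_line (ln m s\<^sub>2)" using mn by auto
  have near_t: "near \<epsilon> p t" if "T s\<^sub>1 t s\<^sub>2" for t
  proof -
    have "len p t \<le> len p s\<^sub>1" using disc_convex[OF that, of p p s\<^sub>1] s2 by simp
    then show ?thesis using s by order
  qed
  from small_conj[OF small_conj[OF same_open[OF L1 c1(1)] same_open[OF L2 c2(1)]]
      small_conj[OF same_open[OF L3 b3'] small_conj[OF opp_open[OF L1 c1(2)] opp_open[OF L2 c2(2)]]]]
  show ?thesis
  proof (rule small_mono, intro allI impI)
    fix \<delta> a' b'
    assume "((\<forall>b'. near \<delta> b b' \<longrightarrow> same (ln m s\<^sub>1) s\<^sub>2 b') \<and> (\<forall>b'. near \<delta> b b' \<longrightarrow> same (ln m s\<^sub>2) s\<^sub>1 b')) \<and>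
        (\<forall>b'. near \<delta> b b' \<longrightarrow> same (ln s\<^sub>1 s\<^sub>2) m b') \<and>
        (\<forall>b'. near \<delta> a b' \<longrightarrow> opp (ln m s\<^sub>1) s\<^sub>2 b') \<and> (\<forall>b'. near \<delta> a b' \<longrightarrow> opp (ln m s\<^sub>2) s\<^sub>1 b')"
      and "near \<delta> a a'" "near \<delta> b b'"
    then have "\<exists>t. Col a' b' t \<and> T s\<^sub>1 t s\<^sub>2" by (intro wedge[OF nc]) blast+
    then show "\<exists>t. Col a' b' t \<and> near \<epsilon> p t" using near_t by blast
  qed
qed

text \<open>For \<open>p\<close> strictly between \<open>a\<close> and \<open>b\<close>, a point
  \<open>q\<close> beyond \<open>b\<close> is approximated first. The approximation
  \<open>q'\<close> and \<open>b'\<close> span the same perturbed line, and seen from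
  \<open>q\<close> the point \<open>p\<close> is beyond \<open>b\<close>.\<close>

lemma line_point_near:
  assumes ab: "a \<noteq> b" and p: "p \<in> ln a b" and e: "pos \<epsilon>"
  shows "small (\<lambda>\<delta>. \<forall>a' b'. near \<delta> a a' \<longrightarrow> near \<delta> b b' \<longrightarrow> (\<exists>t. Col a' b' t \<and> near \<epsilon> p t))"
proof -
  consider "p = a" | "p = b" | "T a b p" "b \<noteq> p" | "T b a p" "a \<noteq> p" | "T a p b" "p \<noteq> a" "p \<noteq> b"
    using p T_sym unfolding ln_def Col_iff by blast
  then show ?thesis
  proof cases
    case 1
    show ?thesis by (rule smallI[OF e]) (use 1 Col_triv(1) order.trans in blast)
  next
    case 2
    show ?thesis by (rule smallI[OF e]) (use 2 Col_triv(2) order.trans in blast)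
  next
    case 3
    then show ?thesis using line_point_near_beyond ab e by blast
  next
    case 4
    from line_point_near_beyond[OF 4(1) ab[symmetric] 4(2) e] show ?thesis
      by (rule small_mono) (use Col_swap(1) in blast)
  next
    case 5
    obtain q where q: "q \<noteq> b" "T a b q" using exists_beyond by blast
    have "T q b p" using q 5 T_exchange(1) T_sym by blast
    from small_ex[OF small_conj[OF line_point_near_beyond[OF this q(1) 5(3)[symmetric] e] neq_open[OF q(1)]]]
    obtain \<epsilon>' where e': "pos \<epsilon>'"
      "\<And>q' b'. near \<epsilon>' q q' \<Longrightarrow> near \<epsilon>' b b' \<Longrightarrow> (\<exists>t. Col q' b' t \<and> near \<epsilon> p t) \<and> q' \<noteq> b'" by blast
    have sm: "small (\<lambda>\<delta>. \<delta> \<le> \<epsilon>')" by (rule smallI[OF e'(1)])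
    from small_conj[OF small_conj[OF line_point_near_beyond[OF q(2) ab q(1)[symmetric] e'(1)] sm] neq_open[OF ab]]
    show ?thesis
    proof (rule small_mono, intro allI impI)
      fix \<delta> a' b'
      assume m: "((\<forall>a' b'. near \<delta> a a' \<longrightarrow> near \<delta> b b' \<longrightarrow> (\<exists>t. Col a' b' t \<and> near \<epsilon>' q t)) \<and> \<delta> \<le> \<epsilon>') \<and>
           (\<forall>p' q'. near \<delta> a p' \<longrightarrow> near \<delta> b q' \<longrightarrow> p' \<noteq> q')"
        and n: "near \<delta> a a'" "near \<delta> b b'"
      obtain q' where q': "Col a' b' q'" "near \<epsilon>' q q'" using m n by blast
      have "near \<epsilon>' b b'" using m n(2) order.trans by blast
      then obtain t where t: "Col q' b' t" "near \<epsilon> p t" "q' \<noteq> b'" using e' q' by blast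
      have "is_line (ln a' b')" using m n by blast
      then have "ln a' b' = ln q' b'" using q' t line_eq_ln ln_mem unfolding ln_def by blast
      then show "\<exists>t. Col a' b' t \<and> near \<epsilon> p t" using t unfolding ln_def by blast
    qed
  qed
qed

subsection \<open>Order on a ray\<close>

lemma ray_T_iff:
  assumes "ray u x y" "ray u y w"
  shows "T x y w \<longleftrightarrow> len u x \<le> len u y \<and> len u y \<le> len u w \<or> len u w \<le> len u y \<and> len u y \<le> len u x"
proof
  assume t: "T x y w"
  have *: "len u x \<le> len u y \<and> len u y \<le> len u w" if "T x y w" "T u x w" for x w
  proof -
    have "T u x y" "T u y w" using that T_inner2[of u x w y] T_inner[of u x w y] by blast+
    then show ?thesis using T_len_le by blast
  qed
  have "T w y x" using t T_sym by blast
  moreover have "T u x w \<or> T u w x" using ray_trans[OF assms] unfolding ray_def by blast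
  ultimately show "len u x \<le> len u y \<and> len u y \<le> len u w \<or> len u w \<le> len u y \<and> len u y \<le> len u x"
    using * t by blast
next
  assume l: "len u x \<le> len u y \<and> len u y \<le> len u w \<or> len u w \<le> len u y \<and> len u y \<le> len u x"
  have *: "T x y w" if "len u x \<le> len u y" "len u y \<le> len u w" "ray u x y" "ray u y w" for x w
    using that T_of_len T_exchange(1) unfolding ray_def by meson
  then show "T x y w" using l assms ray_sym T_sym by blast
qed

lemma ray_eq_iff: "ray u x y \<Longrightarrow> x = y \<longleftrightarrow> len u x = len u y"
  using on_ray_unique unfolding ray_def by blast

text \<open>In terms of distances from \<open>u\<close>, the three clauses cover the positions of
  \<open>y\<close> before \<open>a\<close>, between \<open>a\<close> and \<open>b\<close>, and from
  \<open>b\<close> on; each excludes that \<open>z\<close> comes before \<open>y\<close>.\<close>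

lemma SameOrder_ray:
  assumes r: "ray u a b" "ray u a y" "ray u a z" and l: "len u a < len u b"
  shows "SameOrder a b y z \<longleftrightarrow> len u y \<le> len u z"
proof -
  have base: "ray u a x" if "x \<in> {a, b, y, z}" for x
    using that r unfolding ray_def by auto
  have rr: "ray u x w" if "x \<in> {a, b, y, z}" "w \<in> {a, b, y, z}" for x w
    using ray_trans[OF ray_sym[OF base[OF that(1)]] base[OF that(2)]] .
  have T: "T x v w \<longleftrightarrow> len u x \<le> len u v \<and> len u v \<le> len u w \<or> len u w \<le> len u v \<and> len u v \<le> len u x"
    if "x \<in> {a, b, y, z}" "v \<in> {a, b, y, z}" "w \<in> {a, b, y, z}" for x v w
    using ray_T_iff rr that by blast
  have E: "x = w \<longleftrightarrow> len u x = len u w" if "x \<in> {a, b, y, z}" "w \<in> {a, b, y, z}" for x w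
    using ray_eq_iff rr that by blast
  let ?A = "len u a" and ?B = "len u b" and ?Y = "len u y" and ?Z = "len u z"
  let ?P = "(?Y \<le> ?A \<and> ?A \<le> ?B \<or> ?B \<le> ?A \<and> ?A \<le> ?Y) \<longrightarrow>
      \<not> ((?Z \<le> ?Y \<and> ?Y \<le> ?A \<or> ?A \<le> ?Y \<and> ?Y \<le> ?Z) \<and> ?Z \<noteq> ?Y \<and> ?Y \<noteq> ?A)"
    and ?Q = "(?A \<le> ?Y \<and> ?Y \<le> ?B \<or> ?B \<le> ?Y \<and> ?Y \<le> ?A) \<longrightarrow>
      \<not> ((?Z \<le> ?Y \<and> ?Y \<le> ?B \<or> ?B \<le> ?Y \<and> ?Y \<le> ?Z) \<and> ?Z \<noteq> ?Y \<and> ?Y \<noteq> ?B)"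
    and ?R = "(?A \<le> ?B \<and> ?B \<le> ?Y \<or> ?Y \<le> ?B \<and> ?B \<le> ?A) \<longrightarrow>
      (?A \<le> ?Y \<and> ?Y \<le> ?Z \<or> ?Z \<le> ?Y \<and> ?Y \<le> ?A)"
  have m: "a \<in> {a, b, y, z}" "b \<in> {a, b, y, z}" "y \<in> {a, b, y, z}" "z \<in> {a, b, y, z}" by auto
  have t: "?Y \<le> ?Z \<or> ?Z \<le> ?Y" "?Y \<le> ?A \<or> ?A \<le> ?Y" "?Y \<le> ?B \<or> ?B \<le> ?Y"
    using len_linear by blast+
  have n: "\<not> ?B \<le> ?A" "?A \<le> ?B" using l by order+
  have *: "SameOrder a b y z \<longleftrightarrow> ?P \<and> ?Q \<and> ?R"
    unfolding SameOrder_def B_iff[of z y a] B_iff[of z y b]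
    by (simp only: T[OF m(3,1,2)] T[OF m(4,3,1)] T[OF m(1,3,2)] T[OF m(4,3,2)] T[OF m(1,2,3)]
      T[OF m(1,3,4)] E[OF m(4,3)] E[OF m(3,1)] E[OF m(3,2)])
  show ?thesis
  proof
    assume r: "?Y \<le> ?Z"
    have ?P using r l by (intro impI notI, elim conjE disjE; order)
    moreover have ?Q using r l by (intro impI notI, elim conjE disjE; order)
    moreover have ?R using r n by (blast intro: order.trans)
    ultimately show "SameOrder a b y z" using * by blast
  next
    assume "SameOrder a b y z"
    then have p: ?P ?Q ?R using * by blast+
    show "?Y \<le> ?Z"
    proof (rule ccontr)
      assume "\<not> ?Y \<le> ?Z"
      then have z: "?Z < ?Y" using t(1) by (simp add: less_le_not_le)
      have "?Y \<noteq> ?A \<Longrightarrow> \<not> ?Y \<le> ?A"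
        using p(1) n(2) order.strict_implies_order[OF z] order.strict_implies_not_eq[OF z] by blast
      then have a: "?A \<le> ?Y" using t(2) by (cases "?Y = ?A") simp_all
      then have "?Y \<noteq> ?B \<Longrightarrow> \<not> ?Y \<le> ?B"
        using p(2) order.strict_implies_order[OF z] order.strict_implies_not_eq[OF z] by blast
      then have "?B \<le> ?Y" using t(3) by (cases "?Y = ?B") simp_all
      then have "?A \<le> ?Y \<and> ?Y \<le> ?Z \<or> ?Z \<le> ?Y \<and> ?Y \<le> ?A" using p(3) n(2) by blast
      then show False using z l \<open>?B \<le> ?Y\<close> by (elim conjE disjE; order)
    qed
  qed
qed

lemma ray_shift:
  assumes "T u' u a" "u' \<noteq> u" "ray u a p" shows "T u' u p" "ray u' a p"
proof -
  show "T u' u p"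
    using T_outer(2)[of u' u a p] T_inner[of u' u a p] assms unfolding ray_def by blast
  then have "ray u' u p" "ray u' u a" using assms unfolding ray_def by (metis T_iden)+
  then show "ray u' a p" using ray_trans ray_sym by blast
qed

text \<open>The origin moves back, away from \<open>a\<close>, and past \<open>p\<close> if
  \<open>p\<close> lies behind it. Repeating this puts all the points concerned on one ray.\<close>

lemma exists_far_origin:
  assumes "u \<noteq> a" "p \<in> ln u a" shows "\<exists>u'. u' \<noteq> u \<and> T u' u a \<and> ray u' a p"
proof (cases "T a u p \<and> p \<noteq> u")
  case True
  obtain u' where u': "u' \<noteq> p" "T u p u'" using exists_beyond by blast
  have t: "T a u u'" "T a p u'" using T_outer[of a u p u'] True u' by auto
  then have "u' \<noteq> u" "u' \<noteq> a" using u' True assms by auto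
  moreover have "T u' u a" "T u' p a" using t T_sym by blast+
  ultimately show ?thesis using u' unfolding ray_def by blast
next
  case False
  obtain u' where u': "u' \<noteq> u" "T a u u'" using exists_beyond by blast
  then have t: "T u' u a" using T_sym by blast
  show ?thesis
  proof (cases "p = u")
    case True
    have "u' \<noteq> a" using t assms by auto
    then show ?thesis using t u' True unfolding ray_def by blast
  next
    case False
    then have "ray u a p" using \<open>\<not> (T a u p \<and> p \<noteq> u)\<close> assms T_sym unfolding ray_def ln_def Col_iff by blast
    then show ?thesis using ray_shift t u' by blast
  qed
qed

text \<open>\<open>SameOrder\<close> is not symmetric under reversal, so its meaning is read off
  from an origin \<open>v\<close> at the far end, where \<open>a\<close> is nearer than
  \<open>b\<close>; distances from \<open>v\<close> and from \<open>u\<close> are ordered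
  oppositely.\<close>

lemma SameOrder_ray_reverse:
  assumes r: "ray u b a" "ray u b y" "ray u b z" and l: "len u b < len u a" and so: "SameOrder a b y z"
  shows "len u z \<le> len u y"
proof -
  have *: "\<exists>n. T u m n \<and> T u x n \<and> ray u b n" if "ray u b m" "ray u b x" for m x
  proof -
    have "T u m x \<or> T u x m" using ray_trans[OF ray_sym[OF that(1)] that(2)] unfolding ray_def by blast
    then show ?thesis using that T_triv by blast
  qed
  obtain m\<^sub>1 where m1: "T u a m\<^sub>1" "T u y m\<^sub>1" "ray u b m\<^sub>1" using * r by blast
  obtain m\<^sub>2 where m2: "T u m\<^sub>1 m\<^sub>2" "T u z m\<^sub>2" "ray u b m\<^sub>2" using *[OF m1(3) r(3)] by blast
  obtain v where v: "v \<noteq> m\<^sub>2" "T u m\<^sub>2 v" using exists_beyond by blast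
  have ba: "T u b a" using T_of_len[of u b a] r l unfolding ray_def by auto
  have "T u a m\<^sub>2" "T u y m\<^sub>2" "T u z m\<^sub>2" "T u b m\<^sub>2" using m1 m2 ba T_exchange(2) by blast+
  then have t: "T u a v" "T u y v" "T u z v" "T u b v" and
     tm: "T a m\<^sub>2 v" "T y m\<^sub>2 v" "T z m\<^sub>2 v" "T b m\<^sub>2 v"
    using T_exchange v(2) by blast+
  have ne: "a \<noteq> v" "y \<noteq> v" "z \<noteq> v" "b \<noteq> v" using tm v by auto
  have "u \<noteq> v" using t r unfolding ray_def by auto
  then have "ray v u a" "ray v u y" "ray v u z" "ray v u b"
    using t ne T_sym unfolding ray_def by blast+
  then have rv: "ray v a b" "ray v a y" "ray v a z" using ray_trans[OF ray_sym] by blast+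
  have "T b a v" "b \<noteq> a" using T_exchange(1)[OF ba t(1)] l by auto
  then have "T v a b" using T_sym by blast
  then have "len v a < len v b" using len_strict \<open>b \<noteq> a\<close> by blast
  then have vl: "len v y \<le> len v z" using SameOrder_ray[OF rv] so by blast
  show ?thesis
  proof (rule ccontr)
    assume "\<not> ?thesis"
    then have yz: "len u y < len u z" by (simp add: len_not_le)
    have "T u y z \<or> T u z y" using ray_trans[OF ray_sym[OF r(2)] r(3)] unfolding ray_def by blast
    then have "T u y z" using T_of_len yz by (meson order.strict_implies_order)
    then have "T y z v" using T_exchange(1) t(3) by blast
    then have "T v z y" using T_sym by blast
    moreover have "z \<noteq> y" using yz by auto
    ultimately have "len v z < len v y" using len_strict by blast
    then show False using vl by order
  qed
qed

lemma exists_origin: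
  assumes ab: "a \<noteq> b" and yz: "y \<in> ln a b" "z \<in> ln a b"
  shows "\<exists>u. ray u a b \<and> ray u a y \<and> ray u a z \<and> len u a < len u b"
proof -
  obtain u\<^sub>0 where u0: "u\<^sub>0 \<noteq> a" "T b a u\<^sub>0" using exists_beyond by blast
  then have t0: "T u\<^sub>0 a b" using T_sym by blast
  have L: "is_line (ln a b)" using ab by blast
  have r0: "ray u\<^sub>0 a b" using t0 u0 ab unfolding ray_def by auto
  have u0L: "u\<^sub>0 \<in> ln a b" using T_line(3)[OF L t0] ab by simp
  then have "y \<in> ln u\<^sub>0 a" using line_eq_ln[OF L u0L _ u0(1)] yz by simp
  then obtain u\<^sub>1 where u1: "u\<^sub>1 \<noteq> u\<^sub>0" "T u\<^sub>1 u\<^sub>0 a" "ray u\<^sub>1 a y" using exists_far_origin u0 by blast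
  have u1L: "u\<^sub>1 \<in> ln a b" "u\<^sub>1 \<noteq> a" using T_line(3)[OF L u1(2)] u0L u0 u1 by auto
  then have "z \<in> ln u\<^sub>1 a" using line_eq_ln[OF L u1L(1) _ u1L(2)] yz by simp
  then obtain u where u: "u \<noteq> u\<^sub>1" "T u u\<^sub>1 a" "ray u a z" using exists_far_origin u1L by blast
  have t1: "T u\<^sub>1 a b" using T_outer(1)[OF u1(2) t0 u0(1)] .
  have t: "T u a b" using T_outer(1)[OF u(2) t1 u1L(2)] .
  have "ray u a y" using ray_shift(2)[OF u(2,1) u1(3)] .
  moreover have "ray u a b" using ray_shift(2)[OF u(2,1)] ray_shift(2)[OF u1(2,1) r0] by blast
  moreover have "len u a < len u b" using len_strict t ab by blast
  ultimately show ?thesis using u by blast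
qed

subsection \<open>Continuity of the intersection points\<close>

lemma exists_close_between:
  assumes "y \<noteq> u" "r \<noteq> y" shows "\<exists>s. T y s u \<and> s \<noteq> y \<and> s \<noteq> u \<and> len y s < len y r"
proof -
  \<comment> \<open>The midpoints make both conditions strict: \<open>s\<close> is no farther than
    \<open>m\<close>, hence closer than \<open>r\<close>, and it stays before \<open>w\<close>,
    hence different from \<open>u\<close>.\<close>
  obtain m where m: "T y m r" "len m y = len m r" using exists_midpoint by blast
  obtain w where w: "T y w u" "len w y = len w u" using exists_midpoint by blast
  have ne: "m \<noteq> y" "m \<noteq> r" "w \<noteq> y" "w \<noteq> u" using m w assms by (metis len_eq_0)+
  obtain s where s: "T y s w" "s \<noteq> y" "len y s \<le> len y m"
    using exists_near_on_segment[of "len y m" y w] ne by auto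
  have "T y s u" using T_exchange(2) s w by blast
  moreover have "s \<noteq> u" using s w ne T_antisym by blast
  moreover have "len y s < len y r" using s len_strict[OF m(1) ne(2)] by order
  ultimately show ?thesis using s by blast
qed

abbreviation less_near :: "'p length \<Rightarrow> 'p \<Rightarrow> 'p \<Rightarrow> 'p \<Rightarrow> 'p \<Rightarrow> bool" where
  "less_near \<delta> x y z w \<equiv> \<forall>x' y' z' w'. near \<delta> x x' \<longrightarrow> near \<delta> y y' \<longrightarrow> near \<delta> z z' \<longrightarrow> near \<delta> w w'
    \<longrightarrow> len x' y' < len z' w'"

lemma near_trans: "near \<delta> x x' \<Longrightarrow> \<delta> \<le> \<epsilon> \<Longrightarrow> near \<epsilon> x x'"
  by (rule order.trans)

lemma small_le: "pos \<epsilon> \<Longrightarrow> small (\<lambda>\<delta>. \<delta> \<le> \<epsilon>)"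
  by (rule smallI)

text \<open>The bound holds for every perturbed intersection point, so it serves both terms;
  degenerate circles, \<open>c = d\<close>, belong to this case. The point \<open>t\<close> near
  \<open>y\<close> may lie outside the perturbed circle: it is compared directly with the enclosing
  points.\<close>

lemma tangent_continuous:
  assumes ab: "a \<noteq> b" and y: "y \<in> ln a b" "len c y = len c d"
    and uniq: "\<forall>w\<in>ln a b. len c w = len c d \<longrightarrow> w = y" and r: "r \<noteq> y"
  shows "small (\<lambda>\<delta>. \<forall>a' b' c' d' w. near \<delta> a a' \<longrightarrow> near \<delta> b b' \<longrightarrow> near \<delta> c c' \<longrightarrow> near \<delta> d d' \<longrightarrow>
    a' \<noteq> b' \<longrightarrow> Col a' b' w \<longrightarrow> len c' w = len c' d' \<longrightarrow> len y w \<le> len y r)"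
proof -
  let ?L = "ln a b"
  have L: "is_line ?L" using ab by blast
  obtain u where u: "u \<in> ?L" "u \<noteq> y" using is_line_other L by blast
  obtain y\<^sub>1 where y1: "T y y\<^sub>1 u" "y\<^sub>1 \<noteq> y" "len y y\<^sub>1 < len y r"
    using exists_close_between[OF u(2)[symmetric] r] by blast
  define y\<^sub>2 where "y\<^sub>2 = S y y\<^sub>1"
  have yL: "y\<^sub>1 \<in> ?L" using T_line(2)[OF L y1(1) y(1) u(1)] .
  have y2: "y\<^sub>2 \<in> ?L" "T y\<^sub>1 y y\<^sub>2" "len y y\<^sub>2 < len y r" "y\<^sub>2 \<noteq> y" "y\<^sub>1 \<noteq> y\<^sub>2"
    unfolding y\<^sub>2_def using S_line[OF L y(1) yL] S_spec[of y\<^sub>1 y] S_spec(2)[of y y\<^sub>1] y1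
    by (auto simp del: S_eq_iff simp: S_eq_iff(1))
  \<comment> \<open>A point of the line in the disc is between two intersection points, and here
    both are \<open>y\<close>.\<close>
  have out: "len c d < len c v" if v: "v \<in> ?L" "v \<noteq> y" for v
  proof (rule ccontr)
    assume "\<not> ?thesis"
    then have "len c v \<le> len c d" by (simp add: len_not_less)
    then obtain p q where "p \<in> ?L" "q \<in> ?L" "len c p = len c d" "len c q = len c d" "T p v q"
      using line_meets_circle[OF L v(1)] by blast
    then have "T y v y" using uniq by blast
    then show False using v by simp
  qed
  have l: "len c d < len c y\<^sub>1" "len c d < len c y\<^sub>2" "len c y < len c y\<^sub>1" "len c y < len c y\<^sub>2"
    using out yL y1 y2 y by auto
  from small_ex[OF small_conj[OF small_conj[OF small_conj[OF len_less_open[OF l(1)] len_less_open[OF l(2)]]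
      small_conj[OF len_less_open[OF l(3)] len_less_open[OF l(4)]]]
      small_conj[OF small_conj[OF len_less_open[OF y1(3)] len_less_open[OF y2(3)]]
      small_conj[OF T_open[OF y2(2) y1(2) y2(4)[symmetric]] neq_open[OF y2(5)]]]]]
  obtain \<epsilon> where e: "pos \<epsilon>" and
    e1: "less_near \<epsilon> c d c y\<^sub>1" "less_near \<epsilon> c d c y\<^sub>2" "less_near \<epsilon> c y c y\<^sub>1" "less_near \<epsilon> c y c y\<^sub>2"
      "less_near \<epsilon> y y\<^sub>1 y r" "less_near \<epsilon> y y\<^sub>2 y r" and
    e2: "\<forall>p' q' r'. near \<epsilon> y\<^sub>1 p' \<longrightarrow> near \<epsilon> y q' \<longrightarrow> near \<epsilon> y\<^sub>2 r' \<longrightarrow> Col p' q' r' \<longrightarrow> T p' q' r'" and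
    e3: "\<forall>p' q'. near \<epsilon> y\<^sub>1 p' \<longrightarrow> near \<epsilon> y\<^sub>2 q' \<longrightarrow> p' \<noteq> q'"
    by (elim exE conjE) (rule that)
  from small_conj[OF small_conj[OF line_point_near[OF ab yL e] line_point_near[OF ab y2(1) e]]
      small_conj[OF line_point_near[OF ab y(1) e] small_le[OF e]]]
  show ?thesis
  proof (rule small_mono, intro allI impI)
    fix \<delta> a' b' c' d' w
    assume m: "((\<forall>a' b'. near \<delta> a a' \<longrightarrow> near \<delta> b b' \<longrightarrow> (\<exists>t. Col a' b' t \<and> near \<epsilon> y\<^sub>1 t)) \<and>
         (\<forall>a' b'. near \<delta> a a' \<longrightarrow> near \<delta> b b' \<longrightarrow> (\<exists>t. Col a' b' t \<and> near \<epsilon> y\<^sub>2 t))) \<and>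
        (\<forall>a' b'. near \<delta> a a' \<longrightarrow> near \<delta> b b' \<longrightarrow> (\<exists>t. Col a' b' t \<and> near \<epsilon> y t)) \<and> \<delta> \<le> \<epsilon>"
      and n: "near \<delta> a a'" "near \<delta> b b'" "near \<delta> c c'" "near \<delta> d d'" and ab': "a' \<noteq> b'"
      and w: "Col a' b' w" "len c' w = len c' d'"
    have cd: "near \<epsilon> c c'" "near \<epsilon> d d'" using n m near_trans by blast+
    obtain t\<^sub>1 where t1: "Col a' b' t\<^sub>1" "near \<epsilon> y\<^sub>1 t\<^sub>1" using m n by blast
    obtain t\<^sub>2 where t2: "Col a' b' t\<^sub>2" "near \<epsilon> y\<^sub>2 t\<^sub>2" using m n by blast
    obtain t where t: "Col a' b' t" "near \<epsilon> y t" using m n by blast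
    have ey: "near \<epsilon> y y" "near \<epsilon> r r" using e by simp_all
    have L': "is_line (ln a' b')" using ab' by blast
    have mem: "t\<^sub>1 \<in> ln a' b'" "t\<^sub>2 \<in> ln a' b'" "t \<in> ln a' b'" "w \<in> ln a' b'"
      using t1 t2 t w unfolding ln_def by blast+
    have "t\<^sub>1 \<noteq> t\<^sub>2" using e3 t1 t2 by blast
    then have eq: "ln a' b' = ln t\<^sub>1 t\<^sub>2" using line_eq_ln[OF L'] mem by blast
    then have c: "Col t\<^sub>1 t\<^sub>2 t" "Col t\<^sub>1 t\<^sub>2 w" using mem unfolding ln_def by blast+
    then have tt: "T t\<^sub>1 t t\<^sub>2" using e2 t1 t2 t Col_swap by blast
    have o1: "len c' d' < len c' t\<^sub>1" "len c' d' < len c' t\<^sub>2" "len c' t < len c' t\<^sub>1" "len c' t < len c' t\<^sub>2"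
      using e1 cd t1 t2 t by blast+
    \<comment> \<open>Otherwise the enclosing point would be between \<open>w\<close> and
      \<open>t\<close>, both strictly closer to \<open>c'\<close> than itself.\<close>
    have "\<not> T w t\<^sub>1 t\<^sub>2"
    proof
      assume "T w t\<^sub>1 t\<^sub>2"
      then have "T w t\<^sub>1 t" using T_inner tt by blast
      then show False using disc_convex'[of w t\<^sub>1 t c' c' t\<^sub>1] o1 w(2) by simp
    qed
    moreover have "\<not> T w t\<^sub>2 t\<^sub>1"
    proof
      assume "T w t\<^sub>2 t\<^sub>1"
      then have "T w t\<^sub>2 t" using T_inner tt T_sym by blast
      then show False using disc_convex'[of w t\<^sub>2 t c' c' t\<^sub>2] o1 w(2) by simp
    qed
    ultimately have "T t\<^sub>1 w t\<^sub>2" using c(2) T_sym unfolding Col_iff by blast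
    moreover have "len y t\<^sub>1 < len y r" "len y t\<^sub>2 < len y r" using e1(5,6) ey t1 t2 by blast+
    ultimately have "len y w < len y r" using disc_convex' by blast
    then show "len y w \<le> len y r" by simp
  qed
qed

text \<open>This catches one end of a chord between the outer point \<open>p\<close> and the inner
  point \<open>i\<close>; the choice of the end is left to distances from an origin.\<close>

lemma chord_crossing:
  assumes t: "T e i f" "i \<noteq> e" "i \<noteq> f" and n: "\<not> T e p f" and c: "p \<in> ln e f"
  shows "T p e i \<and> T e i f \<or> T p f i \<and> T f i e"
proof -
  have ef: "e \<noteq> f" using t by auto
  have "T p e f \<or> T e f p" using c n T_sym unfolding ln_def Col_iff by blast
  then show ?thesis
  proof
    assume "T p e f" then show ?thesis using T_inner t T_sym by blast
  next
    assume "T e f p"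
    then have "T p f e" using T_sym by blast
    then show ?thesis using T_inner[of p f e i] t T_sym by blast
  qed
qed

text \<open>The point \<open>u'\<close> is an origin on the perturbed line, close to \<open>u\<close>, from which the order of
  points on this line can be read off as the order of their distances.\<close>

lemma secant_continuous:
  assumes ab: "a \<noteq> b" and y: "y \<in> ln a b" "len c y = len c d" and z: "z \<in> ln a b" "len c z = len c d"
    and uniq: "\<forall>w\<in>ln a b. len c w = len c d \<longrightarrow> w = y \<or> w = z" and r: "r \<noteq> y"
    and u: "ray u a b" "ray u a y" "len u a < len u b" "T u y z" "y \<noteq> z"
  shows "small (\<lambda>\<delta>. \<forall>a' b' c' d' e f. near \<delta> a a' \<longrightarrow> near \<delta> b b' \<longrightarrow> near \<delta> c c' \<longrightarrow> near \<delta> d d' \<longrightarrow>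
    a' \<noteq> b' \<longrightarrow> Col a' b' e \<longrightarrow> len c' e = len c' d' \<longrightarrow> Col a' b' f \<longrightarrow> len c' f = len c' d' \<longrightarrow>
    (\<forall>w. Col a' b' w \<longrightarrow> len c' w = len c' d' \<longrightarrow> w = e \<or> w = f) \<longrightarrow>
    (\<exists>u'. ray u' a' b' \<and> ray u' a' e \<and> ray u' a' f \<and> len u' a' < len u' b' \<and>
      (len u' e \<le> len u' f \<longrightarrow> len y e \<le> len y r)))"
proof -
  let ?L = "ln a b"
  have L: "is_line ?L" using ab by blast
  have uL: "u \<in> ?L" using u(1) T_sym unfolding ray_def ln_def Col_iff by blast
  have uy: "y \<noteq> u" using u unfolding ray_def by blast
  \<comment> \<open>The first enclosing point is taken on the side of the origin, so it is outside
    the circle; the second one, towards \<open>z\<close>, is inside the chord.\<close>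
  obtain y\<^sub>1 where y1: "T y y\<^sub>1 u" "y\<^sub>1 \<noteq> y" "y\<^sub>1 \<noteq> u" "len y y\<^sub>1 < len y r"
    using exists_close_between[OF uy r] by blast
  obtain y\<^sub>2 where y2: "T y y\<^sub>2 z" "y\<^sub>2 \<noteq> y" "y\<^sub>2 \<noteq> z" "len y y\<^sub>2 < len y r"
    using exists_close_between[OF u(5) r] by blast
  have yL: "y\<^sub>1 \<in> ?L" "y\<^sub>2 \<in> ?L" using T_line(2)[OF L] y1(1) y2(1) y(1) z(1) uL by blast+
  have t1: "T u y\<^sub>1 y" using y1 T_sym by blast
  have t2: "T u y y\<^sub>2" using T_inner[of u y z y\<^sub>2] u(4) y2 by blast
  have t12: "T u y\<^sub>1 y\<^sub>2" "T y\<^sub>1 y y\<^sub>2" using T_exchange[OF t1 t2] by blast+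
  have ne12: "y\<^sub>1 \<noteq> y\<^sub>2" using t12(2) y1 by auto
  have ray1: "ray u a y\<^sub>1"
  proof -
    have "ray u y y\<^sub>1" using t1 uy y1 unfolding ray_def by blast
    then show ?thesis using ray_trans u(2) by blast
  qed
  have ins: "len c y\<^sub>2 < len c d" using disc_strictly_convex[OF y2(1-3), of c] y z by simp
  have out: "len c d < len c y\<^sub>1"
  proof (rule ccontr)
    assume "\<not> ?thesis"
    then have "len c y\<^sub>1 \<le> len c d" by (simp add: len_not_less)
    then obtain p q where pq: "p \<in> ?L" "q \<in> ?L" "len c p = len c d" "len c q = len c d" "T p y\<^sub>1 q"
      using line_meets_circle[OF L yL(1)] by blast
    have "p = y \<or> p = z" "q = y \<or> q = z" using uniq pq by blast+
    moreover have "T y\<^sub>1 y z" using T_exchange(1)[OF t1 u(4)] .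
    then have "y\<^sub>1 \<noteq> z" "\<not> T y y\<^sub>1 z" "\<not> T z y\<^sub>1 y" using y1 T_antisym2 u(5) T_sym by (metis T_iden)+
    ultimately show False using pq y1 by auto
  qed
  from small_ex[OF small_conj[OF small_conj[OF small_conj[OF len_less_open[OF ins] len_less_open[OF out]]
      small_conj[OF len_less_open[OF y1(4)] len_less_open[OF y2(4)]]]
      small_conj[OF small_conj[OF len_less_open[OF u(3)] ray_open[OF u(1)]]
      small_conj[OF small_conj[OF ray_open[OF ray1] T_open[OF t12(1) y1(3)[symmetric] ne12]] neq_open[OF ne12]]]]]
  obtain \<epsilon> where e: "pos \<epsilon>" and
    e1: "less_near \<epsilon> c y\<^sub>2 c d" "less_near \<epsilon> c d c y\<^sub>1" "less_near \<epsilon> y y\<^sub>1 y r" "less_near \<epsilon> y y\<^sub>2 y r"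
      "less_near \<epsilon> u a u b" and
    e2: "\<forall>u' a' b'. near \<epsilon> u u' \<longrightarrow> near \<epsilon> a a' \<longrightarrow> near \<epsilon> b b' \<longrightarrow> Col u' a' b' \<longrightarrow> ray u' a' b'"
      "\<forall>u' a' b'. near \<epsilon> u u' \<longrightarrow> near \<epsilon> a a' \<longrightarrow> near \<epsilon> y\<^sub>1 b' \<longrightarrow> Col u' a' b' \<longrightarrow> ray u' a' b'" and
    e3: "\<forall>p' q' r'. near \<epsilon> u p' \<longrightarrow> near \<epsilon> y\<^sub>1 q' \<longrightarrow> near \<epsilon> y\<^sub>2 r' \<longrightarrow> Col p' q' r' \<longrightarrow> T p' q' r'" and
    e4: "\<forall>p' q'. near \<epsilon> y\<^sub>1 p' \<longrightarrow> near \<epsilon> y\<^sub>2 q' \<longrightarrow> p' \<noteq> q'"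
    by (elim exE conjE) (rule that)
  from small_conj[OF small_conj[OF line_point_near[OF ab yL(1) e] line_point_near[OF ab yL(2) e]]
      small_conj[OF line_point_near[OF ab uL e] small_le[OF e]]]
  show ?thesis
  proof (rule small_mono, intro allI impI)
    fix \<delta> a' b' c' d' e f
    assume m: "((\<forall>a' b'. near \<delta> a a' \<longrightarrow> near \<delta> b b' \<longrightarrow> (\<exists>t. Col a' b' t \<and> near \<epsilon> y\<^sub>1 t)) \<and>
         (\<forall>a' b'. near \<delta> a a' \<longrightarrow> near \<delta> b b' \<longrightarrow> (\<exists>t. Col a' b' t \<and> near \<epsilon> y\<^sub>2 t))) \<and>
        (\<forall>a' b'. near \<delta> a a' \<longrightarrow> near \<delta> b b' \<longrightarrow> (\<exists>t. Col a' b' t \<and> near \<epsilon> u t)) \<and> \<delta> \<le> \<epsilon>"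
      and n: "near \<delta> a a'" "near \<delta> b b'" "near \<delta> c c'" "near \<delta> d d'" and ab': "a' \<noteq> b'"
      and ef: "Col a' b' e" "len c' e = len c' d'" "Col a' b' f" "len c' f = len c' d'"
        "\<forall>w. Col a' b' w \<longrightarrow> len c' w = len c' d' \<longrightarrow> w = e \<or> w = f"
    have cd: "near \<epsilon> a a'" "near \<epsilon> b b'" "near \<epsilon> c c'" "near \<epsilon> d d'" using n m near_trans by blast+
    obtain t\<^sub>1 where t1: "Col a' b' t\<^sub>1" "near \<epsilon> y\<^sub>1 t\<^sub>1" using m n by blast
    obtain t\<^sub>2 where t2: "Col a' b' t\<^sub>2" "near \<epsilon> y\<^sub>2 t\<^sub>2" using m n by blast
    obtain u' where u': "Col a' b' u'" "near \<epsilon> u u'" using m n by blast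
    have ey: "near \<epsilon> y y" "near \<epsilon> r r" using e by simp_all
    have L': "is_line (ln a' b')" using ab' by blast
    have mem: "t\<^sub>1 \<in> ln a' b'" "t\<^sub>2 \<in> ln a' b'" "u' \<in> ln a' b'" "e \<in> ln a' b'" "f \<in> ln a' b'"
      using t1 t2 u' ef unfolding ln_def by blast+
    have C: "Col p q s" if "p \<in> ln a' b'" "q \<in> ln a' b'" "s \<in> ln a' b'" for p q s
      using that line_eq_ln[OF L' that(1,2)] by (cases "p = q") (auto simp: ln_def)
    have i: "len c' t\<^sub>2 < len c' d'" and o1: "len c' d' < len c' t\<^sub>1" using e1 cd t1 t2 by blast+
    have rb: "ray u' a' b'" "ray u' a' t\<^sub>1"
      using e2(1)[rule_format, OF u'(2) cd(1,2) C[OF mem(3) ln_mem]]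
        e2(2)[rule_format, OF u'(2) cd(1) t1(2) C[OF mem(3) ln_mem(1) mem(1)]] .
    have ua: "len u' a' < len u' b'" using e1(5) cd u' by blast
    have tu: "T u' t\<^sub>1 t\<^sub>2" using e3[rule_format, OF u'(2) t1(2) t2(2) C[OF mem(3,1,2)]] .
    have tne: "t\<^sub>1 \<noteq> t\<^sub>2" using e4 t1 t2 by blast
    obtain p q where pq: "p \<in> ln a' b'" "q \<in> ln a' b'" "len c' p = len c' d'" "len c' q = len c' d'"
      "T p t\<^sub>2 q"
      using line_meets_circle[OF L' mem(2) order.strict_implies_order[OF i]] by blast
    have tef: "t\<^sub>2 \<noteq> e" "t\<^sub>2 \<noteq> f" using i ef by auto
    have "t\<^sub>2 \<noteq> p" "t\<^sub>2 \<noteq> q" using pq i by auto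
    then have "p \<noteq> q" using pq by auto
    moreover have "p = e \<or> p = f" "q = e \<or> q = f" using ef(5) pq unfolding ln_def by blast+
    ultimately have tt: "T e t\<^sub>2 f" using pq(5) T_sym by blast
    have nt: "\<not> T e t\<^sub>1 f"
    proof
      assume "T e t\<^sub>1 f"
      then have "len c' t\<^sub>1 \<le> len c' d'" using disc_convex[of e t\<^sub>1 f c' c' d'] ef(2,4) by simp
      then show False using o1 by order
    qed
    have "e \<noteq> f" using tt tef by auto
    then have "ln a' b' = ln e f" using line_eq_ln[OF L'] mem by blast
    then have cr: "T t\<^sub>1 e t\<^sub>2 \<and> T e t\<^sub>2 f \<or> T t\<^sub>1 f t\<^sub>2 \<and> T f t\<^sub>2 e"
      using chord_crossing[OF tt tef nt] mem by simp
    have *: "ray u' a' g \<and> ray u' a' h \<and> len u' g < len u' h" if g: "T t\<^sub>1 g t\<^sub>2" "T g t\<^sub>2 h" "t\<^sub>2 \<noteq> g" for g h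
    proof -
      have 1: "T u' t\<^sub>1 g" using T_inner tu g by blast
      have 2: "T u' g t\<^sub>2" using T_inner2 tu g by blast
      have 3: "T u' t\<^sub>2 h" "T u' g h" using T_outer[OF 2 g(2)] g(3) by blast+
      have "u' \<noteq> t\<^sub>1" using rb unfolding ray_def by blast
      then have "ray u' t\<^sub>1 g" "ray u' t\<^sub>1 h"
        using 1 3 T_exchange(2)[OF 1 3(2)] unfolding ray_def by (metis T_iden)+
      moreover have "g \<noteq> h" using g by auto
      ultimately show ?thesis using ray_trans rb(2) len_strict 3(2) by blast
    qed
    have ye: "len y e \<le> len y r" if "T t\<^sub>1 e t\<^sub>2"
    proof -
      have "len y t\<^sub>1 < len y r" "len y t\<^sub>2 < len y r" using e1(3,4) ey t1 t2 by blast+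
      then have "len y e < len y r" using disc_convex' that by blast
      then show ?thesis by simp
    qed
    have "ray u' a' e \<and> ray u' a' f \<and> (len u' e \<le> len u' f \<longrightarrow> len y e \<le> len y r)"
      using cr
    proof
      assume "T t\<^sub>1 e t\<^sub>2 \<and> T e t\<^sub>2 f"
      then show ?thesis using *[of e f] ye tef by blast
    next
      assume "T t\<^sub>1 f t\<^sub>2 \<and> T f t\<^sub>2 e"
      \<comment> \<open>Here \<open>f\<close> is the caught end, so \<open>e\<close> is farther from
        \<open>u'\<close> and the implication is vacuous.\<close>
      then have "ray u' a' f" "ray u' a' e" "len u' f < len u' e" using *[of f e] tef by blast+
      then show ?thesis by (simp add: less_le_not_le)
    qed
    then show "\<exists>u'. ray u' a' b' \<and> ray u' a' e \<and> ray u' a' f \<and> len u' a' < len u' b' \<and>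
      (len u' e \<le> len u' f \<longrightarrow> len y e \<le> len y r)"
      using rb ua by blast
  qed
qed

text \<open>One \<delta> serves all four arguments; the required circles are given by points
  \<open>k x\<close> at distance \<delta> from \<open>x\<close>.\<close>

lemma continuous_term4I:
  assumes "\<And>a b c d r. D a b c d \<Longrightarrow> r \<noteq> t a b c d \<Longrightarrow>
    small (\<lambda>\<delta>. \<forall>a' b' c' d'. near \<delta> a a' \<longrightarrow> near \<delta> b b' \<longrightarrow> near \<delta> c c' \<longrightarrow> near \<delta> d d' \<longrightarrow> D a' b' c' d'
      \<longrightarrow> len (t a b c d) (t a' b' c' d') \<le> len (t a b c d) r)"
  shows "continuous_term4 D t"
  unfolding continuous_term4_def
proof (intro allI impI)
  fix a b c d r assume "D a b c d" "r \<noteq> t a b c d"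
  from small_ex[OF assms[OF this]] obtain \<delta> where \<delta>: "pos \<delta>"
    "\<And>a' b' c' d'. near \<delta> a a' \<Longrightarrow> near \<delta> b b' \<Longrightarrow> near \<delta> c c' \<Longrightarrow> near \<delta> d d' \<Longrightarrow> D a' b' c' d'
      \<Longrightarrow> len (t a b c d) (t a' b' c' d') \<le> len (t a b c d) r" by blast
  have "\<exists>k. k \<noteq> x \<and> len x k = \<delta>" for x
  proof -
    obtain p q where pq: "p \<noteq> q" "\<delta> = len p q" using \<delta>(1) unfolding pos_def by blast
    obtain w where "w \<noteq> x" using exists_other by blast
    then obtain k where k: "len x k = len p q" using segment_extension by blast
    then have "k \<noteq> x" using pq by (metis len_eq_0)
    then show ?thesis using k pq by blast
  qed
  then obtain k where k: "\<And>x. k x \<noteq> x" "\<And>x. len x (k x) = \<delta>" by metis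
  have "inside (t a b c d) r (t z\<^sub>1 z\<^sub>2 z\<^sub>3 z\<^sub>4)"
    if "inside a (k a) z\<^sub>1 \<and> inside b (k b) z\<^sub>2 \<and> inside c (k c) z\<^sub>3 \<and> inside d (k d) z\<^sub>4 \<and>
      D z\<^sub>1 z\<^sub>2 z\<^sub>3 z\<^sub>4" for z\<^sub>1 z\<^sub>2 z\<^sub>3 z\<^sub>4
    using \<delta>(2)[of z\<^sub>1 z\<^sub>2 z\<^sub>3 z\<^sub>4] that by (simp add: inside_iff k(2))
  then show "\<exists>k\<^sub>1 k\<^sub>2 k\<^sub>3 k\<^sub>4. k\<^sub>1 \<noteq> a \<and> k\<^sub>2 \<noteq> b \<and> k\<^sub>3 \<noteq> c \<and> k\<^sub>4 \<noteq> d \<and>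
      (\<forall>z\<^sub>1 z\<^sub>2 z\<^sub>3 z\<^sub>4. inside a k\<^sub>1 z\<^sub>1 \<and> inside b k\<^sub>2 z\<^sub>2 \<and> inside c k\<^sub>3 z\<^sub>3 \<and> inside d k\<^sub>4 z\<^sub>4 \<and>
        D z\<^sub>1 z\<^sub>2 z\<^sub>3 z\<^sub>4 \<longrightarrow> inside (t a b c d) r (t z\<^sub>1 z\<^sub>2 z\<^sub>3 z\<^sub>4))"
    by (intro exI[of _ "k a"] exI[of _ "k b"] exI[of _ "k c"] exI[of _ "k d"]) (simp add: k(1))
qed

section \<open>The terms \<open>ilc\<^sub>1\<close> and \<open>ilc\<^sub>2\<close>\<close>

lemma ilc_spec:
  assumes "ilc_defined a b c d"
  shows "a \<noteq> b" "Col a b (ilc\<^sub>1 a b c d)" "Col a b (ilc\<^sub>2 a b c d)"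
    "len c (ilc\<^sub>1 a b c d) = len c d" "len c (ilc\<^sub>2 a b c d) = len c d"
    "Col a b w \<Longrightarrow> len c w = len c d \<Longrightarrow> w = ilc\<^sub>1 a b c d \<or> w = ilc\<^sub>2 a b c d"
    "SameOrder a b (ilc\<^sub>1 a b c d) (ilc\<^sub>2 a b c d)"
proof -
  show ab: "a \<noteq> b" using assms unfolding ilc_defined_def by blast
  show "Col a b (ilc\<^sub>1 a b c d)" "Col a b (ilc\<^sub>2 a b c d)"
    "len c (ilc\<^sub>1 a b c d) = len c d" "len c (ilc\<^sub>2 a b c d) = len c d"
    "Col a b w \<Longrightarrow> len c w = len c d \<Longrightarrow> w = ilc\<^sub>1 a b c d \<or> w = ilc\<^sub>2 a b c d"
    using line_circle[OF refl refl, of a b c d] assms E_len by blast+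
  show "SameOrder a b (ilc\<^sub>1 a b c d) (ilc\<^sub>2 a b c d)" using line_circle_order[OF refl refl] ab by blast
qed

lemma ilc_tangent_continuous:
  assumes D: "ilc_defined a b c d" and eq: "ilc\<^sub>1 a b c d = ilc\<^sub>2 a b c d" and r: "r \<noteq> ilc\<^sub>1 a b c d"
  shows "small (\<lambda>\<delta>. \<forall>a' b' c' d'. near \<delta> a a' \<longrightarrow> near \<delta> b b' \<longrightarrow> near \<delta> c c' \<longrightarrow> near \<delta> d d' \<longrightarrow>
    ilc_defined a' b' c' d' \<longrightarrow> len (ilc\<^sub>1 a b c d) (ilc\<^sub>1 a' b' c' d') \<le> len (ilc\<^sub>1 a b c d) r \<and>
      len (ilc\<^sub>1 a b c d) (ilc\<^sub>2 a' b' c' d') \<le> len (ilc\<^sub>1 a b c d) r)"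
proof -
  note s = ilc_spec[OF D]
  have "ilc\<^sub>1 a b c d \<in> ln a b" using s unfolding ln_def by blast
  moreover have "\<forall>w\<in>ln a b. len c w = len c d \<longrightarrow> w = ilc\<^sub>1 a b c d"
    using s(6) eq unfolding ln_def by auto
  ultimately have "small (\<lambda>\<delta>. \<forall>a' b' c' d' w. near \<delta> a a' \<longrightarrow> near \<delta> b b' \<longrightarrow> near \<delta> c c' \<longrightarrow> near \<delta> d d' \<longrightarrow>
    a' \<noteq> b' \<longrightarrow> Col a' b' w \<longrightarrow> len c' w = len c' d' \<longrightarrow> len (ilc\<^sub>1 a b c d) w \<le> len (ilc\<^sub>1 a b c d) r)"
    using tangent_continuous[OF s(1) _ s(4) _ r] by blast
  then show ?thesis
  proof (rule small_mono, intro allI impI)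
    fix \<delta> a' b' c' d'
    assume "\<forall>a' b' c' d' w. near \<delta> a a' \<longrightarrow> near \<delta> b b' \<longrightarrow> near \<delta> c c' \<longrightarrow> near \<delta> d d' \<longrightarrow>
        a' \<noteq> b' \<longrightarrow> Col a' b' w \<longrightarrow> len c' w = len c' d' \<longrightarrow> len (ilc\<^sub>1 a b c d) w \<le> len (ilc\<^sub>1 a b c d) r"
      and n: "near \<delta> a a'" "near \<delta> b b'" "near \<delta> c c'" "near \<delta> d d'" and D': "ilc_defined a' b' c' d'"
    note m = this(1)[rule_format, OF n ilc_spec(1)[OF D']]
    show "len (ilc\<^sub>1 a b c d) (ilc\<^sub>1 a' b' c' d') \<le> len (ilc\<^sub>1 a b c d) r \<and>
        len (ilc\<^sub>1 a b c d) (ilc\<^sub>2 a' b' c' d') \<le> len (ilc\<^sub>1 a b c d) r"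
      using m ilc_spec(2-5)[OF D'] by blast
  qed
qed

lemma ilc1_continuous: "continuous_term4 ilc_defined ilc\<^sub>1"
proof (rule continuous_term4I)
  fix a b c d r
  assume D: "ilc_defined a b c d" and r: "r \<noteq> ilc\<^sub>1 a b c d"
  note s = ilc_spec[OF D]
  show "small (\<lambda>\<delta>. \<forall>a' b' c' d'. near \<delta> a a' \<longrightarrow> near \<delta> b b' \<longrightarrow> near \<delta> c c' \<longrightarrow> near \<delta> d d' \<longrightarrow>
    ilc_defined a' b' c' d' \<longrightarrow> len (ilc\<^sub>1 a b c d) (ilc\<^sub>1 a' b' c' d') \<le> len (ilc\<^sub>1 a b c d) r)"
  proof (cases "ilc\<^sub>1 a b c d = ilc\<^sub>2 a b c d")
    case True
    from ilc_tangent_continuous[OF D True r] show ?thesis by (rule small_mono) blast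
  next
    case False
    let ?y = "ilc\<^sub>1 a b c d" and ?z = "ilc\<^sub>2 a b c d"
    have mem: "?y \<in> ln a b" "?z \<in> ln a b" using s unfolding ln_def by blast+
    obtain u where u: "ray u a b" "ray u a ?y" "ray u a ?z" "len u a < len u b"
      using exists_origin[OF s(1) mem] by blast
    have "len u ?y \<le> len u ?z" using SameOrder_ray u s by blast
    then have t: "T u ?y ?z" using T_of_len ray_trans[OF ray_sym[OF u(2)] u(3)] unfolding ray_def by blast
    have "\<forall>w\<in>ln a b. len c w = len c d \<longrightarrow> w = ?y \<or> w = ?z"
      using s(6) unfolding ln_def by blast
    from secant_continuous[OF s(1) mem(1) s(4) mem(2) s(5) this r u(1,2,4) t False] show ?thesis
    proof (rule small_mono, intro allI impI)
      fix \<delta> a' b' c' d'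
      assume m: "\<forall>a' b' c' d' e f. near \<delta> a a' \<longrightarrow> near \<delta> b b' \<longrightarrow> near \<delta> c c' \<longrightarrow> near \<delta> d d' \<longrightarrow>
         a' \<noteq> b' \<longrightarrow> Col a' b' e \<longrightarrow> len c' e = len c' d' \<longrightarrow> Col a' b' f \<longrightarrow> len c' f = len c' d' \<longrightarrow>
         (\<forall>w. Col a' b' w \<longrightarrow> len c' w = len c' d' \<longrightarrow> w = e \<or> w = f) \<longrightarrow>
         (\<exists>u'. ray u' a' b' \<and> ray u' a' e \<and> ray u' a' f \<and> len u' a' < len u' b' \<and>
           (len u' e \<le> len u' f \<longrightarrow> len ?y e \<le> len ?y r))"
        and n: "near \<delta> a a'" "near \<delta> b b'" "near \<delta> c c'" "near \<delta> d d'" and D': "ilc_defined a' b' c' d'"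
      note s' = ilc_spec[OF D']
      obtain u' where u': "ray u' a' b'" "ray u' a' (ilc\<^sub>1 a' b' c' d')" "ray u' a' (ilc\<^sub>2 a' b' c' d')"
        "len u' a' < len u' b'"
        "len u' (ilc\<^sub>1 a' b' c' d') \<le> len u' (ilc\<^sub>2 a' b' c' d') \<longrightarrow> len ?y (ilc\<^sub>1 a' b' c' d') \<le> len ?y r"
        using m[rule_format, OF n s'(1,2,4,3,5)] s'(6) by blast
      \<comment> \<open>\<open>SameOrder\<close> at the perturbed arguments supplies the premise
        that the first intersection is no farther from \<open>u'\<close> than the second.\<close>
      then show "len ?y (ilc\<^sub>1 a' b' c' d') \<le> len ?y r" using SameOrder_ray s'(7) by blast
    qed
  qed
qed

text \<open>Directed from \<open>b\<close> to \<open>a\<close>, the line meets the circle first in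
  \<open>ilc\<^sub>2\<close>; so the secant case applies with \<open>a\<close>, \<open>b\<close> and
  the two intersections exchanged.\<close>

lemma ilc2_continuous: "continuous_term4 ilc_defined ilc\<^sub>2"
proof (rule continuous_term4I)
  fix a b c d r
  assume D: "ilc_defined a b c d" and r: "r \<noteq> ilc\<^sub>2 a b c d"
  note s = ilc_spec[OF D]
  show "small (\<lambda>\<delta>. \<forall>a' b' c' d'. near \<delta> a a' \<longrightarrow> near \<delta> b b' \<longrightarrow> near \<delta> c c' \<longrightarrow> near \<delta> d d' \<longrightarrow>
    ilc_defined a' b' c' d' \<longrightarrow> len (ilc\<^sub>2 a b c d) (ilc\<^sub>2 a' b' c' d') \<le> len (ilc\<^sub>2 a b c d) r)"
  proof (cases "ilc\<^sub>1 a b c d = ilc\<^sub>2 a b c d")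
    case True
    then have "r \<noteq> ilc\<^sub>1 a b c d" using r by simp
    from ilc_tangent_continuous[OF D True this] show ?thesis
      unfolding True by (rule small_mono) blast
  next
    case False
    let ?y = "ilc\<^sub>1 a b c d" and ?z = "ilc\<^sub>2 a b c d"
    have mem: "?y \<in> ln b a" "?z \<in> ln b a" using s Col_swap(1) unfolding ln_def by blast+
    have ba: "b \<noteq> a" using s by simp
    obtain u where u: "ray u b a" "ray u b ?y" "ray u b ?z" "len u b < len u a"
      using exists_origin[OF ba mem] by blast
    have "len u ?z \<le> len u ?y" using SameOrder_ray_reverse u s by blast
    then have t: "T u ?z ?y" using T_of_len ray_trans[OF ray_sym[OF u(3)] u(2)] unfolding ray_def by blast
    have "\<forall>w\<in>ln b a. len c w = len c d \<longrightarrow> w = ?z \<or> w = ?y"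
      using s(6) Col_swap(1) unfolding ln_def by blast
    from secant_continuous[OF ba mem(2) s(5) mem(1) s(4) this r u(1,3,4) t False[symmetric]] show ?thesis
    proof (rule small_mono, intro allI impI)
      fix \<delta> a' b' c' d'
      assume m: "\<forall>b' a' c' d' e f. near \<delta> b b' \<longrightarrow> near \<delta> a a' \<longrightarrow> near \<delta> c c' \<longrightarrow> near \<delta> d d' \<longrightarrow>
         b' \<noteq> a' \<longrightarrow> Col b' a' e \<longrightarrow> len c' e = len c' d' \<longrightarrow> Col b' a' f \<longrightarrow> len c' f = len c' d' \<longrightarrow>
         (\<forall>w. Col b' a' w \<longrightarrow> len c' w = len c' d' \<longrightarrow> w = e \<or> w = f) \<longrightarrow>
         (\<exists>u'. ray u' b' a' \<and> ray u' b' e \<and> ray u' b' f \<and> len u' b' < len u' a' \<and>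
           (len u' e \<le> len u' f \<longrightarrow> len ?z e \<le> len ?z r))"
        and n: "near \<delta> a a'" "near \<delta> b b'" "near \<delta> c c'" "near \<delta> d d'" and D': "ilc_defined a' b' c' d'"
      note s' = ilc_spec[OF D']
      let ?y' = "ilc\<^sub>1 a' b' c' d'" and ?z' = "ilc\<^sub>2 a' b' c' d'"
      have c': "Col b' a' ?z'" "Col b' a' ?y'" "b' \<noteq> a'"
        "\<And>w. Col b' a' w \<Longrightarrow> len c' w = len c' d' \<Longrightarrow> w = ?z' \<or> w = ?y'"
        using s' Col_swap(1) by blast+
      obtain u' where u': "ray u' b' a'" "ray u' b' ?z'" "ray u' b' ?y'" "len u' b' < len u' a'"
        "len u' ?z' \<le> len u' ?y' \<longrightarrow> len ?z ?z' \<le> len ?z r"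
        using m[rule_format, OF n(2,1,3,4) c'(3,1) s'(5) c'(2) s'(4)] c'(4) by blast
      then show "len ?z ?z' \<le> len ?z r" using SameOrder_ray_reverse s'(7) by blast
    qed
  qed
qed

end

theorem lemma6p3:
  fixes B :: "'p \<Rightarrow> 'p \<Rightarrow> 'p \<Rightarrow> bool"
    and E :: "'p \<Rightarrow> 'p \<Rightarrow> 'p \<Rightarrow> 'p \<Rightarrow> bool"
    and \<alpha> \<beta> \<gamma> :: 'p
    and ext :: "'p \<Rightarrow> 'p \<Rightarrow> 'p \<Rightarrow> 'p \<Rightarrow> 'p"
    and ip :: "'p \<Rightarrow> 'p \<Rightarrow> 'p \<Rightarrow> 'p \<Rightarrow> 'p \<Rightarrow> 'p"
    and center :: "'p \<Rightarrow> 'p \<Rightarrow> 'p \<Rightarrow> 'p"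
    and ilc\<^sub>1 ilc\<^sub>2 :: "'p \<Rightarrow> 'p \<Rightarrow> 'p \<Rightarrow> 'p \<Rightarrow> 'p"
  assumes "continuous_tarski B E \<alpha> \<beta> \<gamma> ext ip center ilc\<^sub>1 ilc\<^sub>2"
  shows "tarski_language.continuous_term4 B E (tarski_language.ilc_defined B E) ilc\<^sub>1 \<and>
         tarski_language.continuous_term4 B E (tarski_language.ilc_defined B E) ilc\<^sub>2"
  using continuous_tarski.ilc1_continuous[OF assms] continuous_tarski.ilc2_continuous[OF assms] by blast

end
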